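(* Let $0<b<1<a$ and let $\alpha\in(0,2]$ satisfy $ab^{\alpha}=1$. Let $\{Y(t),t\ge 0\}$ be a real-valued semi-stable($a,b$) process and let $\{T(t),t\ge 0\}$ be a positive semi-selfdecomposable($b^{\alpha}$) process independent of $\{Y(t)\}$. Then the process $\{X(t),t\ge0\}$ with $\{X(t)\}\stackrel{d}{=}\{Y(T(t))\}$, subordinated to $\{Y(t)\}$ by the directing process $\{T(t)\}$, is a semi-selfdecomposable($b$) process.
   Context: A Levy process is a stochastically continuous process $\{X(t),t\ge 0\}$ with stationary independent additive increments and $X(0)=0$. A positive Levy process is one taking values in $[0,\infty)$. If $\{Y(t)\}$ is a Levy process with characteristic function $\exp\{-t\psi(u)\}$ and $\{T(t)\}$ is a positive Levy process independent of $\{Y(t)\}$ whose Laplace transform at time $t$ is $\varphi^t$, the process $\{X(t)\}\stackrel{d}{=}\{Y(T(t))\}$ is said to be subordinated to $\{Y(t)\}$ by the directing process $\{T(t)\}$; its characteristic function at time $t$ is $\{\varphi(\psi(u))\}^t$. Semi-stability is understood in the strict sense: for $0<b<1<a$ a characteristic function $f$ is semi-stable($a,b$) if it is infinitely divisible and $f(u)=\exp\{-\psi(u)\}$ with $\psi(u)=a\psi(bu)$ for all $u\in\mathbf{R}$; its exponent $\alpha\in(0,2]$ is given by $ab^\alpha=1$. For $c\in(0,1)$, a distribution with characteristic function $f$ is semi-selfdecomposable($c$) if there is a characteristic function $f_o$ with $f(s)=f(cs)f_o(s)$ for all $s\in\mathbf{R}$ (for distributions on $[0,\infty)$, the same with Laplace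 transforms: $\varphi(s)=\varphi(cs)\varphi_o(s)$, $s>0$). A Levy process $\{X(t)\}$ is called a semi-stable($a,b$) or semi-selfdecomposable($c$) process if the distribution of $X(1)$ is semi-stable($a,b$) or semi-selfdecomposable($c$), respectively. *)

theory Defs
  imports "HOL-Probability.Probability"
begin

text \<open>
  A real-valued process with time set \<open>[0,\<infinity>)\<close> is a function \<open>X :: real \<Rightarrow> 'a \<Rightarrow> real\<close>;
  its values at negative times are irrelevant.  The law of a process is the image measure of
  its path map on the product sigma-algebra of \<open>\<real>\<^bsup>[0,\<infinity>)\<^esup>\<close>; two processes have the same law iff
  all their finite-dimensional distributions agree.
\<close>

abbreviation path_space :: "(real \<Rightarrow> real) measure" where
  "path_space \<equiv> PiM {0..} (\<lambda>_. borel)"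

definition sample_path :: "(real \<Rightarrow> 'a \<Rightarrow> real) \<Rightarrow> 'a \<Rightarrow> (real \<Rightarrow> real)" where
  "sample_path X \<omega> = (\<lambda>t\<in>{0..}. X t \<omega>)"

definition real_process :: "'a measure \<Rightarrow> (real \<Rightarrow> 'a \<Rightarrow> real) \<Rightarrow> bool" where
  "real_process M X \<longleftrightarrow> prob_space M \<and> (\<forall>t\<ge>0. X t \<in> borel_measurable M)"

definition process_law :: "'a measure \<Rightarrow> (real \<Rightarrow> 'a \<Rightarrow> real) \<Rightarrow> (real \<Rightarrow> real) measure" where
  "process_law M X = distr M path_space (sample_path X)"

definition indep_processes ::
    "'a measure \<Rightarrow> (real \<Rightarrow> 'a \<Rightarrow> real) \<Rightarrow> (real \<Rightarrow> 'a \<Rightarrow> real) \<Rightarrow> bool" where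
  "indep_processes M Y T \<longleftrightarrow>
     prob_space.indep_var M path_space (sample_path Y) path_space (sample_path T)"

definition independent_increments :: "'a measure \<Rightarrow> (real \<Rightarrow> 'a \<Rightarrow> real) \<Rightarrow> bool" where
  "independent_increments M X \<longleftrightarrow>
     (\<forall>(n::nat) (\<tau>::nat \<Rightarrow> real). 0 \<le> \<tau> 0 \<longrightarrow> mono_on {..n} \<tau> \<longrightarrow>
        prob_space.indep_vars M (\<lambda>_. borel) (\<lambda>i \<omega>. X (\<tau> (Suc i)) \<omega> - X (\<tau> i) \<omega>) {..<n})"

definition stationary_increments :: "'a measure \<Rightarrow> (real \<Rightarrow> 'a \<Rightarrow> real) \<Rightarrow> bool" where
  "stationary_increments M X \<longleftrightarrow>
     (\<forall>s\<ge>0. \<forall>h\<ge>0. distr M borel (\<lambda>\<omega>. X (s + h) \<omega> - X s \<omega>)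
                  = distr M borel (\<lambda>\<omega>. X h \<omega> - X 0 \<omega>))"

definition stochastically_continuous :: "'a measure \<Rightarrow> (real \<Rightarrow> 'a \<Rightarrow> real) \<Rightarrow> bool" where
  "stochastically_continuous M X \<longleftrightarrow>
     (\<forall>t\<ge>0. \<forall>\<epsilon>>0.
        ((\<lambda>s. measure M {\<omega> \<in> space M. \<bar>X s \<omega> - X t \<omega>\<bar> > \<epsilon>}) \<longlongrightarrow> 0) (at t within {0..}))"

definition levy_process :: "'a measure \<Rightarrow> (real \<Rightarrow> 'a \<Rightarrow> real) \<Rightarrow> bool" where
  "levy_process M X \<longleftrightarrow>
     real_process M X \<and> (AE \<omega> in M. X 0 \<omega> = 0) \<and>
     independent_increments M X \<and> stationary_increments M X \<and> stochastically_continuous M X"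

definition positive_levy_process :: "'a measure \<Rightarrow> (real \<Rightarrow> 'a \<Rightarrow> real) \<Rightarrow> bool" where
  "positive_levy_process M T \<longleftrightarrow>
     levy_process M T \<and> (\<forall>t\<ge>0. \<forall>\<omega>\<in>space M. 0 \<le> T t \<omega>)"

definition infinitely_divisible :: "real measure \<Rightarrow> bool" where
  "infinitely_divisible \<mu> \<longleftrightarrow>
     real_distribution \<mu> \<and>
     (\<forall>n::nat. n \<ge> 1 \<longrightarrow> (\<exists>\<nu>. real_distribution \<nu> \<and> (\<forall>u. char \<mu> u = char \<nu> u ^ n)))"

text \<open>
  \<open>\<psi>\<close> is the characteristic exponent, i.e. the continuous branch of \<open>- log (char \<mu>)\<close> vanishing
  at \<open>0\<close>; \<open>\<psi> 0 = 0\<close> is forced by the functional equation, as \<open>a \<noteq> 1\<close>.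
\<close>

definition semi_stable :: "real \<Rightarrow> real \<Rightarrow> real measure \<Rightarrow> bool" where
  "semi_stable a b \<mu> \<longleftrightarrow>
     infinitely_divisible \<mu> \<and>
     (\<exists>\<psi>::real \<Rightarrow> complex. continuous_on UNIV \<psi> \<and>
        (\<forall>u. char \<mu> u = exp (- \<psi> u)) \<and>
        (\<forall>u. \<psi> u = complex_of_real a * \<psi> (b * u)))"

definition semi_selfdecomposable :: "real \<Rightarrow> real measure \<Rightarrow> bool" where
  "semi_selfdecomposable c \<mu> \<longleftrightarrow>
     real_distribution \<mu> \<and>
     (\<exists>\<nu>. real_distribution \<nu> \<and> (\<forall>u. char \<mu> u = char \<mu> (c * u) * char \<nu> u))"

definition nonneg_distribution :: "real measure \<Rightarrow> bool" where
  "nonneg_distribution \<mu> \<longleftrightarrow> real_distribution \<mu> \<and> (AE x in \<mu>. 0 \<le> x)"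

definition laplace_transform :: "real measure \<Rightarrow> real \<Rightarrow> real" where
  "laplace_transform \<mu> s = (LINT x|\<mu>. exp (- (s * x)))"

definition semi_selfdecomposable_nonneg :: "real \<Rightarrow> real measure \<Rightarrow> bool" where
  "semi_selfdecomposable_nonneg c \<mu> \<longleftrightarrow>
     nonneg_distribution \<mu> \<and>
     (\<exists>\<nu>. nonneg_distribution \<nu> \<and>
        (\<forall>s>0. laplace_transform \<mu> s = laplace_transform \<mu> (c * s) * laplace_transform \<nu> s))"

definition semi_stable_process ::
    "real \<Rightarrow> real \<Rightarrow> 'a measure \<Rightarrow> (real \<Rightarrow> 'a \<Rightarrow> real) \<Rightarrow> bool" where
  "semi_stable_process a b M X \<longleftrightarrow> levy_process M X \<and> semi_stable a b (distr M borel (X 1))"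

definition semi_selfdecomposable_process ::
    "real \<Rightarrow> 'a measure \<Rightarrow> (real \<Rightarrow> 'a \<Rightarrow> real) \<Rightarrow> bool" where
  "semi_selfdecomposable_process c M X \<longleftrightarrow>
     levy_process M X \<and> semi_selfdecomposable c (distr M borel (X 1))"

definition positive_semi_selfdecomposable_process ::
    "real \<Rightarrow> 'a measure \<Rightarrow> (real \<Rightarrow> 'a \<Rightarrow> real) \<Rightarrow> bool" where
  "positive_semi_selfdecomposable_process c M T \<longleftrightarrow>
     positive_levy_process M T \<and> semi_selfdecomposable_nonneg c (distr M borel (T 1))"

text \<open>
  A stochastically continuous process need not be jointly measurable in time and sample point,
  so \<open>Y (T t)\<close> need not be a random variable.  Even joint measurability over the ambient
  sigma-algebra is not enough for the law of \<open>Y (T t)\<close> to be determined by the laws of \<open>Y\<close> and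
  \<open>T\<close>: replacing \<open>Y s\<close> by \<open>Y s + 1\<close> on the event \<open>T 1 = s\<close> affects neither the law of \<open>Y\<close> nor
  its independence of \<open>T\<close> when \<open>T 1\<close> has a continuous distribution.  As usual, \<open>Y (T t)\<close> is
  therefore formed with a version of \<open>Y\<close> that is jointly measurable over the sigma-algebra
  generated by the process itself; right-continuity of all paths is sufficient for this.
\<close>

definition measurable_process :: "'a measure \<Rightarrow> (real \<Rightarrow> 'a \<Rightarrow> real) \<Rightarrow> bool" where
  "measurable_process M Y \<longleftrightarrow>
     real_process M Y \<and>
     (\<lambda>(t, \<omega>). Y t \<omega>) \<in> borel_measurable
        (restrict_space borel {0..} \<Otimes>\<^sub>M vimage_algebra (space M) (sample_path Y) path_space)"

definition modification ::
    "'a measure \<Rightarrow> (real \<Rightarrow> 'a \<Rightarrow> real) \<Rightarrow> (real \<Rightarrow> 'a \<Rightarrow> real) \<Rightarrow> bool" where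
  "modification M Y' Y \<longleftrightarrow> (\<forall>t\<ge>0. AE \<omega> in M. Y' t \<omega> = Y t \<omega>)"

text \<open>
  The subordinated process is only given in law and may live on a probability space \<open>M\<close> other
  than the space \<open>N\<close> carrying \<open>Y\<close> and \<open>T\<close>.
\<close>

definition subordinated_by ::
    "'b measure \<Rightarrow> (real \<Rightarrow> 'b \<Rightarrow> real) \<Rightarrow>
     'a measure \<Rightarrow> (real \<Rightarrow> 'a \<Rightarrow> real) \<Rightarrow> (real \<Rightarrow> 'a \<Rightarrow> real) \<Rightarrow> bool" where
  "subordinated_by M X N Y T \<longleftrightarrow>
     levy_process N Y \<and> positive_levy_process N T \<and> indep_processes N Y T \<and>
     real_process M X \<and>
     (\<exists>Y'. measurable_process N Y' \<and> modification N Y' Y \<and>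
           process_law M X = process_law N (\<lambda>t \<omega>. Y' (T t \<omega>) \<omega>))"

end

(* Given the path of T, the increments of Y'(T t) are increments of the Levy process Y' over
   consecutive intervals, so the probability that they lie in prescribed sets is the expectation of
   a product of functions of the increments of T.  Independence and stationarity of the increments
   of T thus carry over, and Y'(T t) is a Levy process.

   Let psi be the exponent of Y, L the Laplace transform of T 1, and c = b powr alpha.  The
   characteristic function of X 1 is L(psi u), and psi(b u) = c psi(u).  The factorization
   L(s) = L(c s) L_o(s) extends from s > 0 to the closed right half-plane by uniqueness of Laplace
   transforms; at s = psi u it reads L(psi u) = L(psi(b u)) L_o(psi u), and L_o(psi u) is the
   characteristic function of Y' at an independent time with Laplace transform L_o. *)

theory Submission
  imports Defs
begin


section \<open>Processes with the same law\<close>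

text \<open>The obstacle is measurability. \<open>indep_processes\<close> speaks of the paths of
  \<open>Y\<close> and \<open>T\<close>, while \<open>Y' (T t)\<close> evaluates a modification
  \<open>Y'\<close> at a random time, and the set of sample points where the paths of
  \<open>Y\<close> and \<open>Y'\<close> differ somewhere need not be null. Two facts resolve this.
  A modification changes each single event of the product sigma-algebra by a null set only, so
  independence passes to the events generated by \<open>Y'\<close>; and \<open>Y'\<close> is jointly
  measurable over exactly these events. Hence the path of \<open>T\<close> and the sample point, the
  latter observed only through the sigma-algebra of \<open>Y'\<close>, have a product law, and
  Fubini turns conditioning on \<open>T\<close> into fixing its path. The second difficulty is the
  branch of the exponent: \<open>semi_stable\<close> ties \<psi> to \<open>Y\<close> only through
  exp (- \<psi>) at time 1, which leaves the other times open. Continuity and \<psi> 0 = 0 single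
  out the branch for which time s has characteristic function exp (- s \<psi>).\<close>

lemma sample_path_apply [simp]: "0 \<le> t \<Longrightarrow> sample_path X \<omega> t = X t \<omega>"
  by (simp add: sample_path_def)

lemma real_processD:
  assumes "real_process M X"
  shows "prob_space M" and "0 \<le> t \<Longrightarrow> X t \<in> borel_measurable M"
  using assms by (auto simp: real_process_def)

lemma measurable_sample_path:
  "real_process M X \<Longrightarrow> sample_path X \<in> M \<rightarrow>\<^sub>M path_space"
  unfolding sample_path_def by (intro measurable_restrict) (auto simp: real_process_def)

text \<open>\<open>X\<close> and \<open>Z\<close> may live on different spaces, so they can be
  compared only through path events. Every clause of \<open>levy_process\<close> is later reduced to
  such events.\<close>

lemma process_law_prob_eq:
  assumes "process_law M X = process_law N Z" "real_process M X" "real_process N Z"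
    and P: "Measurable.pred path_space P"
  shows "measure M {\<omega> \<in> space M. P (sample_path X \<omega>)}
       = measure N {\<omega> \<in> space N. P (sample_path Z \<omega>)}"
proof -
  have *: "measure (process_law K V) {x \<in> space path_space. P x}
       = measure K {\<omega> \<in> space K. P (sample_path V \<omega>)}" if "real_process K V" for K :: "'c measure" and V
  proof -
    note [measurable] = measurable_sample_path[OF that] P
    show ?thesis unfolding process_law_def
      by (subst measure_distr)
         (auto intro!: arg_cong[where f="measure K"]
            dest: measurable_space[OF measurable_sample_path[OF that]])
  qed
  show ?thesis using *[OF assms(2)] *[OF assms(3)] assms(1) by simp
qed

text \<open>A product formula for probabilities of events is the form that both a transfer between
  spaces and conditioning on \<open>T\<close> can handle. Subfamilies of the increments are covered,
  since any \<open>A i\<close> may be the whole line.\<close>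

lemma independent_increments_iff:
  assumes "real_process M X"
  shows "independent_increments M X \<longleftrightarrow>
    (\<forall>(n::nat) \<tau> A. 0 \<le> \<tau> 0 \<longrightarrow> mono_on {..n} \<tau> \<longrightarrow> (\<forall>i. A i \<in> sets borel) \<longrightarrow>
       measure M {\<omega> \<in> space M. \<forall>i<n. X (\<tau> (Suc i)) \<omega> - X (\<tau> i) \<omega> \<in> A i}
     = (\<Prod>i<n. measure M {\<omega> \<in> space M. X (\<tau> (Suc i)) \<omega> - X (\<tau> i) \<omega> \<in> A i}))"
proof -
  interpret prob_space M using assms by (rule real_processD)
  have *: "indep_vars (\<lambda>_. borel) (\<lambda>i \<omega>. X (\<tau> (Suc i)) \<omega> - X (\<tau> i) \<omega>) {..<n} \<longleftrightarrow>
     (\<forall>A. (\<forall>i. A i \<in> sets borel) \<longrightarrow>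
       prob {\<omega> \<in> space M. \<forall>i<n. X (\<tau> (Suc i)) \<omega> - X (\<tau> i) \<omega> \<in> A i}
     = (\<Prod>i<n. prob {\<omega> \<in> space M. X (\<tau> (Suc i)) \<omega> - X (\<tau> i) \<omega> \<in> A i}))" (is "?L \<longleftrightarrow> (\<forall>A. ?B A \<longrightarrow> ?R A)")
    if \<tau>: "0 \<le> \<tau> 0" "mono_on {..n} \<tau>" for n :: nat and \<tau> :: "nat \<Rightarrow> real"
  \<comment> \<open>\<open>indep_vars_finite\<close> needs a nonempty index set; without increments
    both sides hold trivially.\<close>
  proof (cases "n = 0")
    case True
    then show ?thesis
      by (simp add: prob_space indep_vars_def indep_sets_def)
  next
    case False
    have pos: "0 \<le> \<tau> i" if "i \<le> n" for i
      using \<tau> that by (metis atMost_iff le0 mono_onD order_trans)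
    have rv: "(\<lambda>\<omega>. X (\<tau> (Suc i)) \<omega> - X (\<tau> i) \<omega>) \<in> borel_measurable M" if "i < n" for i
      using that by (intro borel_measurable_diff real_processD(2)[OF assms] pos) auto
    let ?Q = "\<lambda>A. prob (\<Inter>i<n. (\<lambda>\<omega>. X (\<tau> (Suc i)) \<omega> - X (\<tau> i) \<omega>) -` A i \<inter> space M)
       = (\<Prod>i<n. prob ((\<lambda>\<omega>. X (\<tau> (Suc i)) \<omega> - X (\<tau> i) \<omega>) -` A i \<inter> space M))"
    have "?L \<longleftrightarrow> (\<forall>A\<in>{..<n} \<rightarrow> sets borel. ?Q A)"
      using False rv by (intro indep_vars_finite) (auto simp: sets.Int_stable sets.sigma_sets_eq[of borel, simplified])
    moreover have "?Q A \<longleftrightarrow> ?R A" for A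
    proof -
      have "(\<Inter>i<n. (\<lambda>\<omega>. X (\<tau> (Suc i)) \<omega> - X (\<tau> i) \<omega>) -` A i \<inter> space M)
         = {\<omega> \<in> space M. \<forall>i<n. X (\<tau> (Suc i)) \<omega> - X (\<tau> i) \<omega> \<in> A i}"
        using False by auto
      moreover have "(\<lambda>\<omega>. X (\<tau> (Suc i)) \<omega> - X (\<tau> i) \<omega>) -` A i \<inter> space M
         = {\<omega> \<in> space M. X (\<tau> (Suc i)) \<omega> - X (\<tau> i) \<omega> \<in> A i}" for i by auto
      ultimately show ?thesis by simp
    qed
    moreover have "(\<forall>A\<in>{..<n} \<rightarrow> sets borel. ?R A) \<longleftrightarrow> (\<forall>A. ?B A \<longrightarrow> ?R A)"
    proof safe
      fix A :: "nat \<Rightarrow> real set"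
      assume A: "A \<in> {..<n} \<rightarrow> sets borel" and R: "\<forall>A. ?B A \<longrightarrow> ?R A"
      \<comment> \<open>\<open>R\<close> wants a borel set at every index. Beyond \<open>n\<close>
        the family is set to {}, a value that no condition \<open>i < n\<close> reads.\<close>
      have "?B (\<lambda>i. if i < n then A i else {})"
        using A by (auto simp: Pi_iff)
      then have "?R (\<lambda>i. if i < n then A i else {})"
        by (rule mp[OF spec[OF R]])
      moreover have "{\<omega> \<in> space M. \<forall>i<n. X (\<tau> (Suc i)) \<omega> - X (\<tau> i) \<omega> \<in> (if i < n then A i else {})}
         = {\<omega> \<in> space M. \<forall>i<n. X (\<tau> (Suc i)) \<omega> - X (\<tau> i) \<omega> \<in> A i}" by auto
      ultimately show "?R A" by simp
    qed auto
    ultimately show ?thesis by simp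
  qed
  show ?thesis unfolding independent_increments_def using * by blast
qed

lemma stationary_increments_iff:
  assumes "real_process M X"
  shows "stationary_increments M X \<longleftrightarrow>
    (\<forall>s\<ge>0. \<forall>h\<ge>0. \<forall>A\<in>sets borel.
       measure M {\<omega> \<in> space M. X (s + h) \<omega> - X s \<omega> \<in> A} = measure M {\<omega> \<in> space M. X h \<omega> - X 0 \<omega> \<in> A})"
proof -
  interpret prob_space M using assms by (rule real_processD)
  note [measurable] = real_processD(2)[OF assms]
  have "distr M borel (\<lambda>\<omega>. X (s + h) \<omega> - X s \<omega>) = distr M borel (\<lambda>\<omega>. X h \<omega> - X 0 \<omega>) \<longleftrightarrow>
    (\<forall>A\<in>sets borel. measure M {\<omega> \<in> space M. X (s + h) \<omega> - X s \<omega> \<in> A}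
        = measure M {\<omega> \<in> space M. X h \<omega> - X 0 \<omega> \<in> A})" if [simp]: "s \<ge> 0" "h \<ge> 0" for s h
  proof -
    have [measurable]: "(\<lambda>\<omega>. X (s + h) \<omega> - X s \<omega>) \<in> borel_measurable M" "(\<lambda>\<omega>. X h \<omega> - X 0 \<omega>) \<in> borel_measurable M"
      by measurable
    have *: "measure (distr M borel f) A = measure M {\<omega> \<in> space M. f \<omega> \<in> A}"
      "emeasure (distr M borel f) A = ennreal (measure M {\<omega> \<in> space M. f \<omega> \<in> A})"
      if "f \<in> borel_measurable M" "A \<in> sets borel" for f :: "_ \<Rightarrow> real" and A
      using that by (auto simp: measure_distr emeasure_distr emeasure_eq_measure vimage_def Int_def conj_commute)
    show ?thesis
    proof safe
      fix A :: "real set" assume A: "A \<in> sets borel" and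
        "distr M borel (\<lambda>\<omega>. X (s + h) \<omega> - X s \<omega>) = distr M borel (\<lambda>\<omega>. X h \<omega> - X 0 \<omega>)"
      then show "measure M {\<omega> \<in> space M. X (s + h) \<omega> - X s \<omega> \<in> A}
        = measure M {\<omega> \<in> space M. X h \<omega> - X 0 \<omega> \<in> A}"
        by (subst (1 2) *(1)[symmetric]) auto
    qed (auto intro!: measure_eqI simp: *)
  qed
  then show ?thesis unfolding stationary_increments_def by auto
qed

text \<open>Each defining property concerns only finitely many times at once, hence only the law.
  This is used twice: to pass from \<open>Y\<close> to its modification, and from the subordinated
  process to \<open>X\<close>.\<close>

lemma levy_process_law_cong:
  assumes law: "process_law M X = process_law N Z"
    and X: "real_process M X" and Z: "levy_process N Z"
  shows "levy_process M X"
proof -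
  have Z': "real_process N Z" using Z by (simp add: levy_process_def)
  interpret M: prob_space M using X by (rule real_processD)
  interpret N: prob_space N using Z' by (rule real_processD)
  note [measurable] = real_processD(2)[OF X] real_processD(2)[OF Z']
  note eq = process_law_prob_eq[OF law X Z']
  have [measurable]: "(\<lambda>x. x t) \<in> borel_measurable path_space" if "0 \<le> t" for t
    using that by (intro measurable_component_singleton) auto
  have incr: "measure M {\<omega> \<in> space M. X t \<omega> - X s \<omega> \<in> A} = measure N {\<omega> \<in> space N. Z t \<omega> - Z s \<omega> \<in> A}"
    if [simp, measurable]: "0 \<le> s" "0 \<le> t" "A \<in> sets borel" for s t A
    using eq[of "\<lambda>x. x t - x s \<in> A"] by simp
  have "AE \<omega> in M. X 0 \<omega> = 0"
  proof -
    have "measure N {\<omega> \<in> space N. Z 0 \<omega> = 0} = 1"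
      using Z by (subst N.prob_Collect_eq_1) (auto simp: levy_process_def)
    then show ?thesis
      using eq[of "\<lambda>x. x 0 = 0"] by (subst M.prob_Collect_eq_1[symmetric]) auto
  qed
  moreover have "independent_increments M X"
    unfolding independent_increments_iff[OF X]
  proof safe
    fix n :: nat and \<tau> :: "nat \<Rightarrow> real" and A :: "nat \<Rightarrow> real set"
    assume \<tau>: "0 \<le> \<tau> 0" "mono_on {..n} \<tau>" and A [rule_format, measurable]: "\<forall>i. A i \<in> sets borel"
    have pos: "0 \<le> \<tau> i" if "i \<le> n" for i
      using \<tau> that by (metis atMost_iff le0 mono_onD order_trans)
    have "measure M {\<omega> \<in> space M. \<forall>i<n. X (\<tau> (Suc i)) \<omega> - X (\<tau> i) \<omega> \<in> A i}
      = measure N {\<omega> \<in> space N. \<forall>i<n. Z (\<tau> (Suc i)) \<omega> - Z (\<tau> i) \<omega> \<in> A i}"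
    proof -
      have "Measurable.pred path_space (\<lambda>x. \<forall>i\<in>{..<n}. x (\<tau> (Suc i)) - x (\<tau> i) \<in> A i)"
      proof (intro pred_intros_finite)
        fix i assume "i \<in> {..<n}"
        then have [measurable]: "(\<lambda>x. x (\<tau> (Suc i))) \<in> borel_measurable path_space"
          "(\<lambda>x. x (\<tau> i)) \<in> borel_measurable path_space"
          by (auto intro!: measurable_component_singleton pos)
        show "Measurable.pred path_space (\<lambda>x. x (\<tau> (Suc i)) - x (\<tau> i) \<in> A i)"
          by measurable
      qed auto
      from eq[OF this] show ?thesis by (simp add: pos Ball_def cong: conj_cong)
    qed
    also have "\<dots> = (\<Prod>i<n. measure N {\<omega> \<in> space N. Z (\<tau> (Suc i)) \<omega> - Z (\<tau> i) \<omega> \<in> A i})"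
      using Z \<tau> A independent_increments_iff[OF Z'] by (auto simp: levy_process_def)
    finally show "measure M {\<omega> \<in> space M. \<forall>i<n. X (\<tau> (Suc i)) \<omega> - X (\<tau> i) \<omega> \<in> A i}
      = (\<Prod>i<n. measure M {\<omega> \<in> space M. X (\<tau> (Suc i)) \<omega> - X (\<tau> i) \<omega> \<in> A i})"
      by (simp add: incr pos)
  qed
  moreover have "stationary_increments M X"
    using Z stationary_increments_iff[OF Z'] unfolding stationary_increments_iff[OF X]
    by (auto simp: levy_process_def incr)
  moreover have "stochastically_continuous M X"
    unfolding stochastically_continuous_def
  proof safe
    fix t \<epsilon> :: real assume t: "0 \<le> t" and e: "0 < \<epsilon>"
    have "((\<lambda>s. measure N {\<omega> \<in> space N. \<bar>Z s \<omega> - Z t \<omega>\<bar> > \<epsilon>}) \<longlongrightarrow> 0) (at t within {0..})"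
      using Z t e by (auto simp: levy_process_def stochastically_continuous_def)
    moreover have "measure N {\<omega> \<in> space N. \<bar>Z s \<omega> - Z t \<omega>\<bar> > \<epsilon>} =
       measure M {\<omega> \<in> space M. \<bar>X s \<omega> - X t \<omega>\<bar> > \<epsilon>}" if "0 \<le> s" for s
      using incr[OF t that, of "{x. \<bar>x\<bar> > \<epsilon>}"] by simp
    then have "\<forall>\<^sub>F s in at t within {0..}. measure N {\<omega> \<in> space N. \<bar>Z s \<omega> - Z t \<omega>\<bar> > \<epsilon>} =
       measure M {\<omega> \<in> space M. \<bar>X s \<omega> - X t \<omega>\<bar> > \<epsilon>}"
      by (auto simp: eventually_at_filter)
    ultimately show "((\<lambda>s. measure M {\<omega> \<in> space M. \<bar>X s \<omega> - X t \<omega>\<bar> > \<epsilon>}) \<longlongrightarrow> 0) (at t within {0..})"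
      by (rule Lim_transform_eventually)
  qed
  ultimately show ?thesis using X by (simp add: levy_process_def)
qed


section \<open>The characteristic exponent of a Levy process\<close>

text \<open>Over a grid of step \<open>h\<close>, the increment from 0 to n h is a sum of n
  independent increments with the same law. The value at time 0 vanishes only almost surely, whence
  \<open>char_diff\<close>.\<close>

lemma levy_char_multiple:
  assumes "levy_process M X" "0 \<le> h"
  shows "char (distr M borel (X (real n * h))) u = char (distr M borel (X h)) u ^ n"
proof -
  have X: "real_process M X" and zero: "AE \<omega> in M. X 0 \<omega> = 0"
    using assms by (auto simp: levy_process_def)
  interpret prob_space M using X by (rule real_processD)
  note [measurable] = real_processD(2)[OF X]
  have char_diff: "char (distr M borel (\<lambda>\<omega>. X t \<omega> - X 0 \<omega>)) u = char (distr M borel (X t)) u"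
    if [simp]: "0 \<le> t" for t
    using zero by (intro arg_cong[where f="\<lambda>\<mu>. char \<mu> u"] distr_cong_AE) auto
  define \<tau> where "\<tau> i = real i * h" for i
  have "indep_vars (\<lambda>_. borel) (\<lambda>i \<omega>. X (\<tau> (Suc i)) \<omega> - X (\<tau> i) \<omega>) {..<n}"
  proof -
    have "0 \<le> \<tau> 0" "mono_on {..n} \<tau>"
      using assms(2) by (auto simp: \<tau>_def intro!: mono_onI mult_right_mono)
    then show ?thesis
      using assms(1) unfolding levy_process_def independent_increments_def by blast
  qed
  from char_distr_sum[OF this, of u]
  have "char (distr M borel (\<lambda>\<omega>. \<Sum>i<n. X (\<tau> (Suc i)) \<omega> - X (\<tau> i) \<omega>)) u
      = (\<Prod>i<n. char (distr M borel (\<lambda>\<omega>. X (\<tau> (Suc i)) \<omega> - X (\<tau> i) \<omega>)) u)" .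
  also have "(\<lambda>\<omega>. \<Sum>i<n. X (\<tau> (Suc i)) \<omega> - X (\<tau> i) \<omega>) = (\<lambda>\<omega>. X (\<tau> n) \<omega> - X 0 \<omega>)"
  proof
    show "(\<Sum>i<n. X (\<tau> (Suc i)) \<omega> - X (\<tau> i) \<omega>) = X (\<tau> n) \<omega> - X 0 \<omega>" for \<omega>
      using sum_lessThan_telescope[of "\<lambda>i. X (\<tau> i) \<omega>" n] by (simp add: \<tau>_def)
  qed
  also have "(\<Prod>i<n. char (distr M borel (\<lambda>\<omega>. X (\<tau> (Suc i)) \<omega> - X (\<tau> i) \<omega>)) u) = (\<Prod>i<n. char (distr M borel (X h)) u)"
  proof (rule prod.cong)
    fix i
    have "distr M borel (\<lambda>\<omega>. X (\<tau> i + h) \<omega> - X (\<tau> i) \<omega>) = distr M borel (\<lambda>\<omega>. X h \<omega> - X 0 \<omega>)"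
      using assms by (auto simp: levy_process_def stationary_increments_def \<tau>_def)
    moreover have "\<tau> (Suc i) = \<tau> i + h" by (simp add: \<tau>_def algebra_simps)
    ultimately show "char (distr M borel (\<lambda>\<omega>. X (\<tau> (Suc i)) \<omega> - X (\<tau> i) \<omega>)) u = char (distr M borel (X h)) u"
      using char_diff[OF assms(2)] by simp
  qed simp
  finally show ?thesis using assms(2) by (simp add: char_diff \<tau>_def)
qed

text \<open>The integrands differ by at most \<bar>u\<bar> d where the increment is at most d, and
  by at most 2 elsewhere, an event of small probability.\<close>

lemma stochastically_continuous_char:
  assumes X: "real_process M X" and cont: "stochastically_continuous M X" and t: "0 \<le> t"
  shows "((\<lambda>s. char (distr M borel (X s)) u) \<longlongrightarrow> char (distr M borel (X t)) u) (at t within {0..})"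
proof (rule tendstoI)
  interpret prob_space M using X by (rule real_processD)
  note [measurable] = real_processD(2)[OF X]
  fix e :: real assume e: "0 < e"
  \<comment> \<open>This makes \<bar>u\<bar> d at most e / 2, the added 1 covering u = 0. The
    exceptional event then gets probability below e / 4, as it is weighted by 2.\<close>
  define d where "d = e / (2 * (\<bar>u\<bar> + 1))"
  have d: "0 < d" "\<bar>u\<bar> * d \<le> e / 2"
    using e by (auto simp: d_def field_simps)
  let ?p = "\<lambda>s. prob {\<omega> \<in> space M. \<bar>X s \<omega> - X t \<omega>\<bar> > d}"
  have bound: "norm (char (distr M borel (X s)) u - char (distr M borel (X t)) u) \<le> e / 2 + 2 * ?p s"
    if s: "0 \<le> s" for s
  proof -
    note [simp] = s t
    have int: "integrable M (\<lambda>\<omega>. iexp (u * X r \<omega>))" if [simp]: "0 \<le> r" for r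
      by (intro integrable_iexp) auto
    let ?S = "{\<omega> \<in> space M. \<bar>X s \<omega> - X t \<omega>\<bar> > d}"
    have "norm (char (distr M borel (X s)) u - char (distr M borel (X t)) u)
        = norm (CLINT \<omega>|M. iexp (u * X s \<omega>) - iexp (u * X t \<omega>))"
      using int by (simp add: char_def integral_distr del: of_real_mult)
    also have "\<dots> \<le> (LINT \<omega>|M. norm (iexp (u * X s \<omega>) - iexp (u * X t \<omega>)))"
      by (rule integral_norm_bound)
    also have "\<dots> \<le> (LINT \<omega>|M. e / 2 + 2 * indicator ?S \<omega>)"
    proof (rule integral_mono)
      fix \<omega> assume \<omega>: "\<omega> \<in> space M"
      show "norm (iexp (u * X s \<omega>) - iexp (u * X t \<omega>)) \<le> e / 2 + 2 * indicator ?S \<omega>"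
      proof (cases "\<omega> \<in> ?S")
        case True
        have "norm (iexp (u * X s \<omega>) - iexp (u * X t \<omega>)) \<le> 1 + 1"
          by (rule order_trans[OF norm_triangle_ineq4]) (simp del: of_real_mult)
        then show ?thesis using True e by simp
      next
        case False
        have "iexp (u * X s \<omega>) - iexp (u * X t \<omega>) = iexp (u * X t \<omega>) * (iexp (u * (X s \<omega> - X t \<omega>)) - 1)"
          by (simp add: algebra_simps flip: exp_add)
        then have "norm (iexp (u * X s \<omega>) - iexp (u * X t \<omega>)) = norm (iexp (u * (X s \<omega> - X t \<omega>)) - 1)"
          by (simp add: norm_mult del: of_real_mult)
        also have "\<dots> \<le> \<bar>u * (X s \<omega> - X t \<omega>)\<bar>"
          using iexp_approx1[of "u * (X s \<omega> - X t \<omega>)" 0] by simp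
        also have "\<dots> \<le> \<bar>u\<bar> * d"
          using False \<omega> by (auto simp: abs_mult intro!: mult_left_mono)
        finally show ?thesis using d False by simp
      qed
    next
      show "integrable M (\<lambda>\<omega>. norm (iexp (u * X s \<omega>) - iexp (u * X t \<omega>)))"
        by (intro integrable_norm Bochner_Integration.integrable_diff int s t)
      show "integrable M (\<lambda>\<omega>. e / 2 + 2 * indicator ?S \<omega>)"
        by (intro Bochner_Integration.integrable_add integrable_const integrable_mult_right
              integrable_real_indicator) (auto simp: less_top[symmetric])
    qed
    also have "\<dots> = (LINT \<omega>|M. e / 2) + (LINT \<omega>|M. 2 * indicator ?S \<omega>)"
      by (intro Bochner_Integration.integral_add integrable_const integrable_mult_right
            integrable_real_indicator) (auto simp: less_top[symmetric])
    also have "\<dots> = e / 2 + 2 * ?p s"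
      by (simp add: prob_space)
    finally show ?thesis .
  qed
  have "(?p \<longlongrightarrow> 0) (at t within {0..})"
    using cont t d by (auto simp: stochastically_continuous_def)
  then have "\<forall>\<^sub>F s in at t within {0..}. ?p s < e / 4"
    by (rule order_tendstoD) (use e in simp)
  moreover have "\<forall>\<^sub>F s in at t within {0..}. 0 \<le> s"
    by (auto simp: eventually_at_filter)
  ultimately show "\<forall>\<^sub>F s in at t within {0..}.
      dist (char (distr M borel (X s)) u) (char (distr M borel (X t)) u) < e"
    by eventually_elim (use bound in \<open>force simp: dist_norm\<close>)
qed

lemma levy_char_root:
  fixes \<psi> :: "real \<Rightarrow> complex"
  assumes X: "levy_process M X" and n: "n \<noteq> 0"
    and \<psi>: "continuous_on UNIV \<psi>" "\<psi> 0 = 0" "\<And>u. char (distr M borel (X 1)) u = exp (- \<psi> u)"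
  shows "char (distr M borel (X (1 / real n))) u = exp (- \<psi> u / of_nat n)"
proof -
  have rp: "real_process M X" using X by (simp add: levy_process_def)
  interpret prob_space M using rp by (rule real_processD)
  let ?\<mu> = "distr M borel (X (1 / real n))"
  interpret \<mu>: real_distribution ?\<mu>
    using real_processD(2)[OF rp] by (intro real_distribution_distr) auto
  \<comment> \<open>\<open>g\<close> is continuous with values in the \<open>n\<close>-th roots of unity, hence constant.\<close>
  define g where "g u = char ?\<mu> u * exp (\<psi> u / of_nat n)" for u
  have g: "g u ^ n = 1" for u
  proof -
    have "char ?\<mu> u ^ n = exp (- \<psi> u)"
      using levy_char_multiple[OF X, of "1 / real n" n u] n by (simp add: \<psi>(3))
    then have "g u ^ n = exp (- \<psi> u) * exp (\<psi> u)"
      using n by (simp add: g_def power_mult_distrib flip: exp_of_nat_mult)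
    then show ?thesis by (simp add: exp_minus)
  qed
  have "continuous_on UNIV g"
    unfolding g_def using \<mu>.isCont_char
    by (intro continuous_intros \<psi> continuous_at_imp_continuous_on) (auto simp: n)
  moreover have "finite (range g)"
    by (rule finite_subset[OF _ finite_roots_unity[of n, where 'a=complex]]) (use g n in auto)
  ultimately have "g constant_on UNIV"
    by (intro continuous_finite_range_constant) auto
  then have "g u = g 0" by (auto simp: constant_on_def)
  also have "g 0 = 1" by (simp add: g_def \<psi> \<mu>.char_zero)
  finally show ?thesis by (simp add: g_def exp_minus field_simps)
qed

text \<open>Powers of the roots at times 1 / n settle all rational times, and stochastic continuity
  extends the formula to real ones.\<close>

lemma levy_char_exponent:
  fixes \<psi> :: "real \<Rightarrow> complex"
  assumes X: "levy_process M X" and s: "0 \<le> s"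
    and \<psi>: "continuous_on UNIV \<psi>" "\<psi> 0 = 0" "\<And>u. char (distr M borel (X 1)) u = exp (- \<psi> u)"
  shows "char (distr M borel (X s)) u = exp (- (of_real s * \<psi> u))"
proof (rule LIMSEQ_unique)
  \<comment> \<open>The largest multiple of 1 / (n + 1) that does not exceed \<open>s\<close>; it
    misses \<open>s\<close> by less than 1 / (n + 1).\<close>
  define q where "q n = real (nat \<lfloor>s * real (Suc n)\<rfloor>) / real (Suc n)" for n
  have q: "q \<longlonglongrightarrow> s"
  proof (rule tendsto_sandwich)
    have "s * real (Suc n) - 1 \<le> real (nat \<lfloor>s * real (Suc n)\<rfloor>)" for n
      by linarith
    then have "(s * real (Suc n) - 1) / real (Suc n) \<le> q n" for n
      unfolding q_def by (intro divide_right_mono) auto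
    then show "\<forall>\<^sub>F n in sequentially. s - 1 / real (Suc n) \<le> q n"
      by (intro always_eventually allI) (simp add: diff_divide_distrib del: of_nat_Suc)
    have "real (nat \<lfloor>s * real (Suc n)\<rfloor>) \<le> s * real (Suc n)" for n
      using s by simp
    then show "\<forall>\<^sub>F n in sequentially. q n \<le> s"
      by (intro always_eventually allI) (simp add: q_def field_simps del: of_nat_Suc)
    have "(\<lambda>n. s - 1 / real (Suc n)) \<longlonglongrightarrow> s - 0"
      by (intro tendsto_intros LIMSEQ_Suc lim_1_over_n)
    then show "(\<lambda>n. s - 1 / real (Suc n)) \<longlonglongrightarrow> s" by simp
  qed simp
  have "char (distr M borel (X (q n))) u = exp (- (of_real (q n) * \<psi> u))" for n
    using levy_char_multiple[OF X, of "1 / real (Suc n)" "nat \<lfloor>s * real (Suc n)\<rfloor>" u]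
      levy_char_root[OF X _ \<psi>, of "Suc n" u]
    by (simp add: q_def del: of_nat_Suc flip: exp_of_nat_mult)
  moreover have "(\<lambda>n. exp (- (of_real (q n) * \<psi> u))) \<longlonglongrightarrow> exp (- (of_real s * \<psi> u))"
    by (intro tendsto_intros q)
  ultimately show "(\<lambda>n. char (distr M borel (X (q n))) u) \<longlonglongrightarrow> exp (- (of_real s * \<psi> u))"
    by simp
  have "continuous (at s within {0..}) (\<lambda>s. char (distr M borel (X s)) u)"
    unfolding continuous_within
    using X s by (intro stochastically_continuous_char) (auto simp: levy_process_def)
  moreover have "q n \<in> {0..}" for n by (simp add: q_def)
  ultimately show "(\<lambda>n. char (distr M borel (X (q n))) u) \<longlonglongrightarrow> char (distr M borel (X s)) u"
    using q unfolding continuous_within_sequentially by (auto simp: comp_def)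
qed

text \<open>A characteristic function has modulus at most 1. This keeps \<psi> u in the closed right
  half-plane, where Laplace transforms of distributions on [0, \<infinity>) converge.\<close>

lemma levy_exponent_Re_nonneg:
  fixes \<psi> :: "real \<Rightarrow> complex"
  assumes "real_distribution \<mu>" "char \<mu> u = exp (- \<psi> u)"
  shows "0 \<le> Re (\<psi> u)"
  using real_distribution.cmod_char_le_1[OF assms(1), of u] assms(2) by simp


section \<open>Uniqueness of Laplace transforms on the right half-plane\<close>

lemma (in real_distribution) nonneg_integral_bound:
  fixes f g :: "real \<Rightarrow> 'b :: {banach, second_countable_topology}"
  assumes "AE x in M. 0 \<le> x" "integrable M f" "integrable M g" 
    and "\<And>x. 0 \<le> x \<Longrightarrow> norm (f x - g x) \<le> e"
  shows "norm ((LINT x|M. f x) - (LINT x|M. g x)) \<le> e"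
proof -
  have "norm ((LINT x|M. f x) - (LINT x|M. g x)) = norm (LINT x|M. f x - g x)"
    using assms by simp
  also have "\<dots> \<le> (LINT x|M. norm (f x - g x))" by (rule integral_norm_bound)
  also have "\<dots> \<le> (LINT x|M. e)"
    by (rule integral_mono_AE) (use assms in auto)
  finally show ?thesis using prob_space by simp
qed

text \<open>Laplace transforms at positive integers are moments of y = exp (- x), and polynomials
  are uniformly dense on [0, 1]. The absolute value keeps y in [0, 1], where \<open>h\<close> is
  controlled, also on the null set of negative x.\<close>

lemma nonneg_integral_eq_of_laplace_eq:
  fixes h :: "real \<Rightarrow> real"
  assumes \<mu>: "nonneg_distribution \<mu>" and \<nu>: "nonneg_distribution \<nu>"
    and L: "\<And>s. 0 < s \<Longrightarrow> laplace_transform \<mu> s = laplace_transform \<nu> s"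
    and h: "continuous_on {0..1} h"
  shows "(LINT x|\<mu>. h (exp (- \<bar>x\<bar>))) = (LINT x|\<nu>. h (exp (- \<bar>x\<bar>)))"
proof -
  interpret \<mu>: real_distribution \<mu> using \<mu> by (simp add: nonneg_distribution_def)
  interpret \<nu>: real_distribution \<nu> using \<nu> by (simp add: nonneg_distribution_def)
  have ae: "AE x in \<mu>. 0 \<le> x" "AE x in \<nu>. 0 \<le> x"
    using \<mu> \<nu> by (auto simp: nonneg_distribution_def)
  obtain B where B: "\<And>y. y \<in> {0..1} \<Longrightarrow> \<bar>h y\<bar> \<le> B"
    using compact_imp_bounded[OF compact_continuous_image[OF h compact_Icc]]
    by (auto simp: bounded_iff simp del: atLeastAtMost_iff)
  have meas: "(\<lambda>x. h (exp (- \<bar>x\<bar>))) \<in> borel_measurable borel"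
    by (intro borel_measurable_continuous_onI continuous_on_compose2[OF h] continuous_intros) auto
  have int: "integrable \<rho> (\<lambda>x. h (exp (- \<bar>x\<bar>)))" if "real_distribution \<rho>" for \<rho>
  proof -
    interpret real_distribution \<rho> by fact
    show ?thesis using meas B by (intro integrable_const_bound[of _ B]) auto
  qed
  have intp: "integrable \<rho> (\<lambda>x. exp (- \<bar>x\<bar>) ^ i)" if "real_distribution \<rho>" for \<rho> i
  proof -
    interpret real_distribution \<rho> by fact
    show ?thesis by (intro integrable_const_bound[of _ 1]) (auto simp: power_le_one)
  qed
  have "(LINT x|\<mu>. exp (- \<bar>x\<bar>) ^ i) = (LINT x|\<nu>. exp (- \<bar>x\<bar>) ^ i)" for i :: nat
  \<comment> \<open>\<open>L\<close> covers positive arguments only; for \<open>i = 0\<close> both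
    integrals are the total mass 1.\<close>
  proof (cases "i = 0")
    case False
    have "(LINT x|\<rho>. exp (- \<bar>x\<bar>) ^ i) = laplace_transform \<rho> (real i)"
      if "AE x in \<rho>. 0 \<le> x" "real_distribution \<rho>" for \<rho>
    proof -
      interpret real_distribution \<rho> by fact
      show ?thesis unfolding laplace_transform_def
      proof (intro integral_cong_AE)
        show "AE x in \<rho>. exp (- \<bar>x\<bar>) ^ i = exp (- (real i * x))"
          using that(1) by eventually_elim (simp flip: exp_of_nat_mult)
      qed auto
    qed
    then show ?thesis using L[of "real i"] False ae \<mu>.real_distribution_axioms \<nu>.real_distribution_axioms
      by simp
  qed (simp add: \<mu>.prob_space[simplified] \<nu>.prob_space[simplified])
  then have poly: "(LINT x|\<mu>. (\<Sum>i\<le>n. a i * exp (- \<bar>x\<bar>) ^ i)) = (LINT x|\<nu>. (\<Sum>i\<le>n. a i * exp (- \<bar>x\<bar>) ^ i))"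
    for a :: "nat \<Rightarrow> real" and n
    by (subst (1 2) Bochner_Integration.integral_sum)
       (auto intro!: integrable_mult_right intp \<mu>.real_distribution_axioms \<nu>.real_distribution_axioms)
  have "\<bar>(LINT x|\<mu>. h (exp (- \<bar>x\<bar>))) - (LINT x|\<nu>. h (exp (- \<bar>x\<bar>)))\<bar> \<le> 0 + e" if "0 < e" for e
  proof -
    \<comment> \<open>The error e / 2 is paid once for each of the two measures.\<close>
    obtain p where p: "real_polynomial_function p" "\<And>y. y \<in> {0..1} \<Longrightarrow> \<bar>h y - p y\<bar> < e / 2"
      using Stone_Weierstrass_real_polynomial_function[OF compact_Icc h, of "e / 2"] \<open>0 < e\<close> by auto
    then obtain a n where a: "p = (\<lambda>x. \<Sum>i\<le>n. a i * x ^ i)"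
      by (auto simp: real_polynomial_function_iff_sum)
    have intq: "integrable \<rho> (\<lambda>x. p (exp (- \<bar>x\<bar>)))" if "real_distribution \<rho>" for \<rho>
      unfolding a by (intro Bochner_Integration.integrable_sum integrable_mult_right intp that)
    have "norm (h (exp (- \<bar>x\<bar>)) - p (exp (- \<bar>x\<bar>))) \<le> e / 2" for x
      using p(2)[of "exp (- \<bar>x\<bar>)"] by simp
    then have "norm ((LINT x|\<rho>. h (exp (- \<bar>x\<bar>))) - (LINT x|\<rho>. p (exp (- \<bar>x\<bar>)))) \<le> e / 2"
      if "real_distribution \<rho>" "AE x in \<rho>. 0 \<le> x" for \<rho>
      using that by (intro real_distribution.nonneg_integral_bound int intq)
    from this[OF \<mu>.real_distribution_axioms ae(1)] this[OF \<nu>.real_distribution_axioms ae(2)]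
    show ?thesis using poly[of a n] unfolding a real_norm_def by linarith
  qed
  then have "\<bar>(LINT x|\<mu>. h (exp (- \<bar>x\<bar>))) - (LINT x|\<nu>. h (exp (- \<bar>x\<bar>)))\<bar> \<le> 0"
    by (rule field_le_epsilon)
  then show ?thesis by simp
qed

text \<open>For \<open>Re z > 0\<close>, \<open>exp (- z x)\<close> is a continuous function of \<open>y = exp (- x)\<close> on \<open>[0, 1]\<close>, so that
  Weierstrass approximation replaces analytic continuation.\<close>

lemma continuous_on_powr_unit:
  fixes z :: complex
  assumes z: "0 < Re z"
  shows "continuous_on {0..1} (\<lambda>y::real. if y = 0 then 0 else exp (z * of_real (ln y)))"
    (is "continuous_on _ ?f")
proof (unfold continuous_on_eq_continuous_within, intro ballI)
  fix y :: real assume y: "y \<in> {0..1}"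
  show "continuous (at y within {0..1}) ?f"
  proof (cases "y = 0")
    case True
    have "continuous_on {0..1} (\<lambda>y::real. y powr Re z)"
      using z by (intro continuous_on_powr' continuous_intros) auto
    then have "((\<lambda>y. y powr Re z) \<longlongrightarrow> 0) (at 0 within {0..1})"
      unfolding continuous_on using z by (auto dest: bspec[of _ _ 0])
    moreover have "\<forall>\<^sub>F y in at 0 within {0..1}. norm (?f y) \<le> y powr Re z"
      by (auto simp: eventually_at_filter powr_def)
    ultimately have "(?f \<longlongrightarrow> 0) (at 0 within {0..1})"
      by (rule Lim_null_comparison[rotated])
    then show ?thesis using True by (simp add: continuous_within)
  next
    case False
    then have "isCont (\<lambda>y. exp (z * of_real (ln y))) y"
      by (intro continuous_intros) auto
    moreover have "\<forall>\<^sub>F x in nhds y. exp (z * of_real (ln x)) = ?f x"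
      using t1_space_nhds[OF False] by eventually_elim auto
    ultimately have "isCont ?f y"
      by (simp add: isCont_cong)
    then show ?thesis by (rule continuous_at_imp_continuous_at_within)
  qed
qed

lemma nonneg_integrable_exp:
  assumes "nonneg_distribution \<mu>" "0 \<le> Re z"
  shows "integrable \<mu> (\<lambda>x. exp (- (z * of_real x)))"
proof -
  interpret real_distribution \<mu> using assms by (simp add: nonneg_distribution_def)
  show ?thesis
    by (rule integrable_const_bound[of _ 1])
       (use assms in \<open>auto simp: nonneg_distribution_def\<close>)
qed

text \<open>In the open half-plane the real and imaginary parts of the integrand are continuous
  functions of exp (- x), to which the moment argument applies. The boundary is reached by a
  limit.\<close>

lemma complex_laplace_unique:
  fixes z :: complex
  assumes \<mu>: "nonneg_distribution \<mu>" and \<nu>: "nonneg_distribution \<nu>"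
    and L: "\<And>s. 0 < s \<Longrightarrow> laplace_transform \<mu> s = laplace_transform \<nu> s"
    and z: "0 \<le> Re z"
  shows "(CLINT x|\<mu>. exp (- (z * of_real x))) = (CLINT x|\<nu>. exp (- (z * of_real x)))"
proof -
  have pos: "(CLINT x|\<mu>. exp (- (w * of_real x))) = (CLINT x|\<nu>. exp (- (w * of_real x)))"
    if w: "0 < Re w" for w
  proof -
    \<comment> \<open>The value 0 at y = 0 is the limit for x tending to infinity, so
      \<open>f\<close> is continuous on the closed interval.\<close>
    define f where "f y = (if y = 0 then 0 else exp (w * of_real (ln y)))" for y :: real
    have f: "continuous_on {0..1} f"
      unfolding f_def by (rule continuous_on_powr_unit[OF w])
    have f_exp: "f (exp (- \<bar>x\<bar>)) = exp (- (w * of_real \<bar>x\<bar>))" for x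
      by (simp add: f_def)
    have eq: "Re (CLINT x|\<rho>. exp (- (w * of_real x))) = (LINT x|\<rho>. Re (f (exp (- \<bar>x\<bar>))))"
        "Im (CLINT x|\<rho>. exp (- (w * of_real x))) = (LINT x|\<rho>. Im (f (exp (- \<bar>x\<bar>))))"
      if \<rho>: "nonneg_distribution \<rho>" for \<rho>
    proof -
      interpret real_distribution \<rho> using \<rho> by (simp add: nonneg_distribution_def)
      have ae: "AE x in \<rho>. 0 \<le> x" using \<rho> by (simp add: nonneg_distribution_def)
      have int: "integrable \<rho> (\<lambda>x. exp (- (w * of_real x)))"
        using \<rho> w by (intro nonneg_integrable_exp) auto
      show "Re (CLINT x|\<rho>. exp (- (w * of_real x))) = (LINT x|\<rho>. Re (f (exp (- \<bar>x\<bar>))))"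
        unfolding integral_Re[OF int, symmetric] f_exp
        by (intro integral_cong_AE) (use ae in auto)
      show "Im (CLINT x|\<rho>. exp (- (w * of_real x))) = (LINT x|\<rho>. Im (f (exp (- \<bar>x\<bar>))))"
        unfolding integral_Im[OF int, symmetric] f_exp
        by (intro integral_cong_AE) (use ae in auto)
    qed
    show ?thesis
      unfolding complex_eq_iff eq[OF \<mu>] eq[OF \<nu>]
      by (intro conjI nonneg_integral_eq_of_laplace_eq[OF \<mu> \<nu> L] continuous_intros f)
  qed
  \<comment> \<open>For Re z = 0 the integrand need not have a limit as y = exp (- x) tends to 0.
    Points shifted into the open half-plane converge to \<open>z\<close>, and the constant 1
    dominates their integrands on x \<ge> 0.\<close>
  define w where "w n = z + of_real (1 / real (Suc n))" for n
  have "(\<lambda>n. 1 / real (Suc n)) \<longlonglongrightarrow> 0" by (intro LIMSEQ_Suc lim_1_over_n)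
  then have "(\<lambda>n. of_real (1 / real (Suc n)) :: complex) \<longlonglongrightarrow> of_real 0"
    by (rule tendsto_of_real)
  then have "w \<longlonglongrightarrow> z + of_real 0"
    unfolding w_def by (rule tendsto_add[OF tendsto_const])
  then have w: "w \<longlonglongrightarrow> z" by simp
  have w_pos: "0 < Re (w n)" for n using z by (simp add: w_def add_nonneg_pos)
  have lim: "(\<lambda>n. CLINT x|\<rho>. exp (- (w n * of_real x))) \<longlonglongrightarrow> (CLINT x|\<rho>. exp (- (z * of_real x)))"
    if \<rho>: "nonneg_distribution \<rho>" for \<rho>
  proof -
    interpret real_distribution \<rho> using \<rho> by (simp add: nonneg_distribution_def)
    have ae: "AE x in \<rho>. 0 \<le> x" using \<rho> by (simp add: nonneg_distribution_def)
    show ?thesis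
    proof (rule integral_dominated_convergence[where w="\<lambda>_. 1"])
      show "AE x in \<rho>. (\<lambda>n. exp (- (w n * of_real x))) \<longlonglongrightarrow> exp (- (z * of_real x))"
        by (intro AE_I2 tendsto_intros w)
      show "AE x in \<rho>. norm (exp (- (w n * of_real x))) \<le> 1" for n
        using ae by eventually_elim (use w_pos[of n] in auto)
    qed auto
  qed
  show ?thesis
    using lim[OF \<mu>] lim[OF \<nu>] by (simp add: pos[OF w_pos] LIMSEQ_unique)
qed


section \<open>Subordination\<close>

text \<open>The sets with this property form a sigma-algebra containing the one-coordinate
  cylinders, because countably many null sets have a null union. The null set depends on
  \<open>A\<close>; the paths themselves need not agree almost surely.\<close>

lemma modification_path_AE:
  assumes mod: "modification N Y' Y" and A: "A \<in> sets path_space"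
  shows "AE \<omega> in N. sample_path Y' \<omega> \<in> A \<longleftrightarrow> sample_path Y \<omega> \<in> A"
  using A unfolding sets_PiM_single
proof (induction rule: sigma_sets.induct)
  case (Basic a)
  then obtain t B where "0 \<le> t" and a: "a = {f \<in> {0..} \<rightarrow>\<^sub>E UNIV. f t \<in> B}"
    by auto
  then have "AE \<omega> in N. Y' t \<omega> = Y t \<omega>" using mod by (auto simp: modification_def)
  then show ?case
    by eventually_elim (use \<open>0 \<le> t\<close> in \<open>auto simp: a sample_path_def PiE_iff extensional_def\<close>)
next
  case (Compl a)
  from Compl.IH show ?case
    by eventually_elim (auto simp: sample_path_def PiE_iff extensional_def)
next
  case (Union a)
  then have "AE \<omega> in N. \<forall>i. sample_path Y' \<omega> \<in> a i \<longleftrightarrow> sample_path Y \<omega> \<in> a i"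
    by (simp add: AE_all_countable)
  then show ?case by eventually_elim auto
qed simp

lemma modification_process_law_eq:
  assumes mod: "modification N Y' Y" and Y: "real_process N Y" and Y': "real_process N Y'"
  shows "process_law N Y' = process_law N Y"
  unfolding process_law_def
proof (rule measure_eqI)
  note [measurable] = measurable_sample_path[OF Y] measurable_sample_path[OF Y']
  fix A assume "A \<in> sets (distr N path_space (sample_path Y'))"
  then have A [measurable]: "A \<in> sets path_space" by simp
  show "emeasure (distr N path_space (sample_path Y')) A = emeasure (distr N path_space (sample_path Y)) A"
    using modification_path_AE[OF mod A] by (auto simp: emeasure_distr intro!: emeasure_eq_AE)
qed simp

section \<open>Joint measurability, and independence as a product law\<close>

locale subordination =
  fixes N :: "'a measure" and Y Y' T :: "real \<Rightarrow> 'a \<Rightarrow> real"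
  assumes levy_Y: "levy_process N Y" and levy_T: "positive_levy_process N T"
    and indep: "indep_processes N Y T"
    and meas_Y': "measurable_process N Y'" and mod: "modification N Y' Y"
begin

abbreviation path_algebra :: "'a measure" where
  "path_algebra \<equiv> vimage_algebra (space N) (sample_path Y') path_space"

text \<open>The restriction of \<open>N\<close> to the events generated by \<open>Y'\<close>,
  written as an image under the identity. Only for these events is independence of \<open>T\<close>
  available, so this is the second factor of the product law.\<close>

definition path_prob :: "'a measure" where
  "path_prob = distr N path_algebra (\<lambda>\<omega>. \<omega>)"

text \<open>Truncating time at \<open>0\<close> makes \<open>Y'\<close> jointly measurable on all of \<open>\<real>\<close>, not just on \<open>[0,\<infinity>)\<close>.\<close>

definition Y_max :: "real \<Rightarrow> 'a \<Rightarrow> real" where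
  "Y_max s = Y' (max 0 s)"

definition subord :: "real \<Rightarrow> 'a \<Rightarrow> real" where
  "subord t \<omega> = Y' (T t \<omega>) \<omega>"

text \<open>For 0 \<le> s this is the transition kernel of \<open>Y'\<close>. \<open>Y_max\<close>
  makes it borel measurable on the whole line, so that it applies to differences of
  \<open>T\<close>, which are nonnegative only almost surely.\<close>

definition incr_prob :: "real set \<Rightarrow> real \<Rightarrow> ennreal" where
  "incr_prob A s = emeasure N {\<omega> \<in> space N. Y_max s \<omega> - Y_max 0 \<omega> \<in> A}"

lemma Y_real: "real_process N Y" and T_real: "real_process N T" and Y'_real: "real_process N Y'"
  using levy_Y levy_T meas_Y'
  by (auto simp: levy_process_def positive_levy_process_def measurable_process_def)

sublocale prob_space N
  using Y_real by (rule real_processD)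

lemmas [measurable] = real_processD(2)[OF Y_real] real_processD(2)[OF T_real] real_processD(2)[OF Y'_real]
  measurable_sample_path[OF Y_real] measurable_sample_path[OF T_real] measurable_sample_path[OF Y'_real]

lemma T_nonneg: "0 \<le> t \<Longrightarrow> \<omega> \<in> space N \<Longrightarrow> 0 \<le> T t \<omega>"
  using levy_T by (auto simp: positive_levy_process_def)

lemma T_zero: "AE \<omega> in N. T 0 \<omega> = 0"
  using levy_T by (auto simp: positive_levy_process_def levy_process_def)

lemma levy_Y': "levy_process N Y'"
  by (rule levy_process_law_cong[OF modification_process_law_eq[OF mod Y_real Y'_real] Y'_real levy_Y])

lemma measurable_id_path_algebra [measurable]: "(\<lambda>\<omega>. \<omega>) \<in> N \<rightarrow>\<^sub>M path_algebra"
  by (rule measurable_vimage_algebra2) auto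

lemma space_path_prob [simp]: "space path_prob = space N"
  and sets_path_prob [measurable_cong]: "sets path_prob = sets path_algebra"
  by (simp_all add: path_prob_def)

lemma prob_space_path_prob: "prob_space path_prob"
  unfolding path_prob_def by (intro prob_space_distr) measurable

lemma measurable_Y_max: "case_prod Y_max \<in> borel_measurable (borel \<Otimes>\<^sub>M path_algebra)"
proof -
  have "(\<lambda>x. (max 0 (fst x), snd x)) \<in> borel \<Otimes>\<^sub>M path_algebra \<rightarrow>\<^sub>M restrict_space borel {0::real..} \<Otimes>\<^sub>M path_algebra"
    by (intro measurable_Pair measurable_restrict_space2) auto
  from measurable_compose[OF this, of "\<lambda>(t, \<omega>). Y' t \<omega>" borel] meas_Y' show ?thesis
    by (simp add: measurable_process_def Y_max_def case_prod_beta')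
qed

lemma measurable_Y_max_compose [measurable (raw)]:
  assumes "f \<in> borel_measurable K" "g \<in> K \<rightarrow>\<^sub>M path_algebra"
  shows "(\<lambda>x. Y_max (f x) (g x)) \<in> borel_measurable K"
  using measurable_compose[OF measurable_Pair[OF assms] measurable_Y_max] by simp

lemma subord_eq: "0 \<le> t \<Longrightarrow> \<omega> \<in> space N \<Longrightarrow> subord t \<omega> = Y_max (T t \<omega>) \<omega>"
  using T_nonneg by (simp add: subord_def Y_max_def)

lemma subord_real: "real_process N subord"
  unfolding real_process_def
proof (intro conjI allI impI)
  fix t :: real assume [simp]: "0 \<le> t"
  have "(\<lambda>\<omega>. Y_max (T t \<omega>) \<omega>) \<in> borel_measurable N" by measurable
  then show "subord t \<in> borel_measurable N"
    by (subst measurable_cong[OF subord_eq]) auto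
qed (rule prob_space_axioms)

text \<open>Every event of \<open>path_algebra\<close> is the preimage of a path event under
  \<open>Y'\<close>. Replacing \<open>Y'\<close> by \<open>Y\<close> in it costs a null set, and
  then the independence of \<open>Y\<close> and \<open>T\<close> applies.\<close>

lemma indep_path_events:
  assumes B: "B \<in> sets path_algebra" and C: "C \<in> sets path_space"
  shows "prob {\<omega> \<in> space N. \<omega> \<in> B \<and> sample_path T \<omega> \<in> C}
       = prob B * prob {\<omega> \<in> space N. sample_path T \<omega> \<in> C}"
proof -
  obtain A where A [measurable]: "A \<in> sets path_space" and B: "B = {\<omega> \<in> space N. sample_path Y' \<omega> \<in> A}"
  proof -
    have "sample_path Y' \<in> space N \<rightarrow> space path_space"
      using measurable_space[OF measurable_sample_path[OF Y'_real]] by blast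
    from B[unfolded sets_vimage_algebra2[OF this]] show ?thesis
      using that by auto
  qed
  note [measurable] = C
  note ae = modification_path_AE[OF mod A]
  have "prob {\<omega> \<in> space N. \<omega> \<in> B \<and> sample_path T \<omega> \<in> C}
      = prob {\<omega> \<in> space N. sample_path Y' \<omega> \<in> A \<and> sample_path T \<omega> \<in> C}"
    by (rule arg_cong[where f=prob]) (auto simp: B)
  also have "\<dots> = prob {\<omega> \<in> space N. sample_path Y \<omega> \<in> A \<and> sample_path T \<omega> \<in> C}"
    by (rule finite_measure_eq_AE) (use ae in auto)
  also have "\<dots> = prob {\<omega> \<in> space N. sample_path Y \<omega> \<in> A} * prob {\<omega> \<in> space N. sample_path T \<omega> \<in> C}"
    using indep_varD[OF indep[unfolded indep_processes_def] A C]
    by (simp add: vimage_def Int_def conj_commute)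
  also have "prob {\<omega> \<in> space N. sample_path Y \<omega> \<in> A} = prob B"
    unfolding B by (rule finite_measure_eq_AE) (use ae in auto)
  finally show ?thesis .
qed

text \<open>The sample point determines the path of \<open>T\<close>, yet the law is a product,
  since the second component is observed only through \<open>Y'\<close>. The map \<open>g\<close> is
  left free to serve for the whole path as well as for a single value \<open>T t\<close>.\<close>

lemma distr_T_path_pair:
  assumes g [measurable]: "g \<in> path_space \<rightarrow>\<^sub>M K"
  shows "distr N (K \<Otimes>\<^sub>M path_algebra) (\<lambda>\<omega>. (g (sample_path T \<omega>), \<omega>))
       = distr N K (\<lambda>\<omega>. g (sample_path T \<omega>)) \<Otimes>\<^sub>M path_prob"
proof (rule pair_measure_eqI[symmetric])
  show "sigma_finite_measure (distr N K (\<lambda>\<omega>. g (sample_path T \<omega>)))" "sigma_finite_measure path_prob"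
    by (auto intro!: prob_space_imp_sigma_finite prob_space_distr prob_space_path_prob)
  fix A B assume "A \<in> sets (distr N K (\<lambda>\<omega>. g (sample_path T \<omega>)))" "B \<in> sets path_prob"
  then have A [measurable]: "A \<in> sets K" and B: "B \<in> sets path_algebra" by (auto simp: sets_path_prob)
  have "(\<lambda>\<omega>. \<omega>) -` B \<inter> space N \<in> sets N"
    using B by (rule measurable_sets[OF measurable_id_path_algebra])
  then have [measurable]: "B \<in> sets N"
    using sets.sets_into_space[OF B] by (simp add: Int_absorb2)
  have C: "g -` A \<inter> space path_space \<in> sets path_space" by measurable
  have T_space: "sample_path T \<omega> \<in> space path_space" if "\<omega> \<in> space N" for \<omega>
    using that by (rule measurable_space[rotated]) measurable
  have "emeasure (distr N K (\<lambda>\<omega>. g (sample_path T \<omega>))) A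
      = prob {\<omega> \<in> space N. sample_path T \<omega> \<in> g -` A \<inter> space path_space}"
    using T_space by (subst emeasure_distr) (auto simp: emeasure_eq_measure intro!: arg_cong[where f=prob])
  moreover have "emeasure path_prob B = prob B"
    using B sets.sets_into_space[OF B]
    by (simp add: path_prob_def emeasure_distr emeasure_eq_measure Int_absorb2)
  moreover have "emeasure (distr N (K \<Otimes>\<^sub>M path_algebra) (\<lambda>\<omega>. (g (sample_path T \<omega>), \<omega>))) (A \<times> B)
      = prob {\<omega> \<in> space N. \<omega> \<in> B \<and> sample_path T \<omega> \<in> g -` A \<inter> space path_space}"
    using T_space B by (subst emeasure_distr) (auto simp: emeasure_eq_measure intro!: arg_cong[where f=prob])
  ultimately show "emeasure (distr N K (\<lambda>\<omega>. g (sample_path T \<omega>))) A * emeasure path_prob B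
      = emeasure (distr N (K \<Otimes>\<^sub>M path_algebra) (\<lambda>\<omega>. (g (sample_path T \<omega>), \<omega>))) (A \<times> B)"
    using indep_path_events[OF B C] by (simp add: ennreal_mult[symmetric] mult.commute)
qed (simp add: sets_path_prob cong: sets_pair_measure_cong)

text \<open>By stationarity the increment has the law of \<open>T (t - s) - T 0\<close>, which is
  almost surely nonnegative because \<open>T\<close> takes nonnegative values and starts at 0 almost
  surely.\<close>

lemma T_mono_AE:
  assumes st: "0 \<le> s" "s \<le> t"
  shows "AE \<omega> in N. T s \<omega> \<le> T t \<omega>"
proof -
  have [simp]: "0 \<le> t" "0 \<le> t - s" using st by auto
  have "stationary_increments N T"
    using levy_T by (simp add: positive_levy_process_def levy_process_def)
  note stat = this[unfolded stationary_increments_iff[OF T_real], rule_format]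
  have "prob {\<omega> \<in> space N. T (s + (t - s)) \<omega> - T s \<omega> \<in> {0..}}
      = prob {\<omega> \<in> space N. T (t - s) \<omega> - T 0 \<omega> \<in> {0..}}"
    by (rule stat) (use st in auto)
  moreover have "AE \<omega> in N. T (t - s) \<omega> - T 0 \<omega> \<in> {0..}"
    using T_zero AE_space by eventually_elim (use T_nonneg[of "t - s"] st in auto)
  ultimately have "prob {\<omega> \<in> space N. T (s + (t - s)) \<omega> - T s \<omega> \<in> {0..}} = 1"
    using st by (subst (asm) prob_Collect_eq_1[symmetric]) auto
  then show ?thesis
    using st by (subst (asm) prob_Collect_eq_1) auto
qed

section \<open>Increments of the subordinated process\<close>

lemma measurable_incr_prob [measurable]:
  assumes [measurable]: "A \<in> sets borel"
  shows "incr_prob A \<in> borel_measurable borel"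
proof -
  have "{x \<in> space (borel \<Otimes>\<^sub>M N). Y_max (fst x) (snd x) - Y_max 0 (snd x) \<in> A} \<in> sets (borel \<Otimes>\<^sub>M N)"
    by measurable
  from measurable_emeasure_Pair[OF this] show ?thesis
    by (simp add: incr_prob_def[abs_def] space_pair_measure vimage_def)
qed

text \<open>Meant for the times \<open>T (\<tau> i) \<omega>\<close> at a fixed \<omega>, which are
  ordered but otherwise arbitrary.\<close>

lemma Y'_increments:
  assumes \<sigma>: "0 \<le> \<sigma> 0" "mono_on {..n} \<sigma>" and A: "\<And>i. A i \<in> sets borel"
  shows "emeasure N {\<omega> \<in> space N. \<forall>i<n. Y_max (\<sigma> (Suc i)) \<omega> - Y_max (\<sigma> i) \<omega> \<in> A i}
       = (\<Prod>i<n. incr_prob (A i) (\<sigma> (Suc i) - \<sigma> i))"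
proof -
  have le: "\<sigma> i \<le> \<sigma> j" if "i \<le> j" "j \<le> n" for i j
    using \<sigma> that by (auto elim!: mono_onD)
  then have pos: "0 \<le> \<sigma> i" if "i \<le> n" for i
    using \<sigma>(1) that order_trans by blast
  have Y_max: "Y_max (\<sigma> i) = Y' (\<sigma> i)" if "i \<le> n" for i
    using pos[OF that] by (simp add: Y_max_def)
  have "independent_increments N Y'" "stationary_increments N Y'"
    using levy_Y' by (auto simp: levy_process_def)
  note indep = this(1)[unfolded independent_increments_iff[OF Y'_real], rule_format, OF \<sigma> A]
    and stat = this(2)[unfolded stationary_increments_iff[OF Y'_real], rule_format, OF _ _ A]
  have "emeasure N {\<omega> \<in> space N. \<forall>i<n. Y_max (\<sigma> (Suc i)) \<omega> - Y_max (\<sigma> i) \<omega> \<in> A i}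
      = ennreal (prob {\<omega> \<in> space N. \<forall>i<n. Y' (\<sigma> (Suc i)) \<omega> - Y' (\<sigma> i) \<omega> \<in> A i})"
    by (simp add: emeasure_eq_measure Y_max cong: conj_cong)
  also have "\<dots> = (\<Prod>i<n. ennreal (prob {\<omega> \<in> space N. Y' (\<sigma> (Suc i)) \<omega> - Y' (\<sigma> i) \<omega> \<in> A i}))"
    by (simp add: indep prod_ennreal)
  also have "\<dots> = (\<Prod>i<n. incr_prob (A i) (\<sigma> (Suc i) - \<sigma> i))"
  proof (rule prod.cong)
    fix i assume "i \<in> {..<n}"
    then have "prob {\<omega> \<in> space N. Y' (\<sigma> i + (\<sigma> (Suc i) - \<sigma> i)) \<omega> - Y' (\<sigma> i) \<omega> \<in> A i}
       = prob {\<omega> \<in> space N. Y' (\<sigma> (Suc i) - \<sigma> i) \<omega> - Y' 0 \<omega> \<in> A i}"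
      using le[of i "Suc i"] by (intro stat pos) auto
    then show "ennreal (prob {\<omega> \<in> space N. Y' (\<sigma> (Suc i)) \<omega> - Y' (\<sigma> i) \<omega> \<in> A i})
      = incr_prob (A i) (\<sigma> (Suc i) - \<sigma> i)"
      using le[of i "Suc i"] \<open>i \<in> {..<n}\<close>
      by (simp add: incr_prob_def emeasure_eq_measure Y_max_def)
  qed simp
  finally show ?thesis .
qed

text \<open>Tonelli for the product law of the path of \<open>T\<close> and the sample point: with
  the path held fixed, the random times become deterministic ones. The formula reduces all questions
  about the increments of \<open>subord\<close> to those of \<open>T\<close>.\<close>

lemma subord_increments_cond:
  assumes \<tau>: "0 \<le> \<tau> 0" "mono_on {..n} \<tau>" and A [measurable]: "\<And>i. A i \<in> sets borel"
  shows "emeasure N {\<omega> \<in> space N. \<forall>i<n. subord (\<tau> (Suc i)) \<omega> - subord (\<tau> i) \<omega> \<in> A i}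
       = (\<integral>\<^sup>+ \<omega>. (\<Prod>i<n. incr_prob (A i) (T (\<tau> (Suc i)) \<omega> - T (\<tau> i) \<omega>)) \<partial>N)"
proof -
  interpret PP: prob_space path_prob by (rule prob_space_path_prob)
  have le: "\<tau> i \<le> \<tau> j" if "i \<le> j" "j \<le> n" for i j
    using \<tau> that by (auto elim!: mono_onD)
  then have pos: "0 \<le> \<tau> i" if "i \<le> n" for i
    using \<tau>(1) that order_trans by blast
  \<comment> \<open>The first component is a path of \<open>T\<close>, used only to supply times;
    the second is the sample point at which \<open>Y'\<close> is evaluated.\<close>
  define C where "C = {x \<in> space (path_space \<Otimes>\<^sub>M path_algebra).
     \<forall>i\<in>{..<n}. Y_max (fst x (\<tau> (Suc i))) (snd x) - Y_max (fst x (\<tau> i)) (snd x) \<in> A i}"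
  have C: "C \<in> sets (path_space \<Otimes>\<^sub>M path_algebra)"
    unfolding C_def
  proof (intro sets.sets_Collect_finite_All)
    fix i assume "i \<in> {..<n}"
    then have [measurable]: "(\<lambda>x. x (\<tau> (Suc i))) \<in> borel_measurable path_space"
      "(\<lambda>x. x (\<tau> i)) \<in> borel_measurable path_space"
      by (auto intro!: measurable_component_singleton pos)
    show "{x \<in> space (path_space \<Otimes>\<^sub>M path_algebra). Y_max (fst x (\<tau> (Suc i))) (snd x) - Y_max (fst x (\<tau> i)) (snd x) \<in> A i}
       \<in> sets (path_space \<Otimes>\<^sub>M path_algebra)"
      by measurable
  qed auto
  let ?T = "distr N path_space (sample_path T)"
  have C': "C \<in> sets (?T \<Otimes>\<^sub>M path_prob)"
    using C by (simp add: sets_path_prob cong: sets_pair_measure_cong)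
  have T_space: "sample_path T \<omega> \<in> space path_space" if "\<omega> \<in> space N" for \<omega>
    using that by (rule measurable_space[rotated]) measurable
  have "emeasure N {\<omega> \<in> space N. \<forall>i<n. subord (\<tau> (Suc i)) \<omega> - subord (\<tau> i) \<omega> \<in> A i}
      = emeasure (distr N (path_space \<Otimes>\<^sub>M path_algebra) (\<lambda>\<omega>. (sample_path T \<omega>, \<omega>))) C"
  proof (subst emeasure_distr)
    show "emeasure N {\<omega> \<in> space N. \<forall>i<n. subord (\<tau> (Suc i)) \<omega> - subord (\<tau> i) \<omega> \<in> A i}
      = emeasure N ((\<lambda>\<omega>. (sample_path T \<omega>, \<omega>)) -` C \<inter> space N)"
      using T_space by (intro arg_cong[where f="emeasure N"]) (auto simp: C_def space_pair_measure pos subord_eq)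
  qed (use C in auto)
  also have "\<dots> = emeasure (?T \<Otimes>\<^sub>M path_prob) C"
    using distr_T_path_pair[of "\<lambda>x. x" path_space] by simp
  also have "\<dots> = (\<integral>\<^sup>+ x. emeasure path_prob (Pair x -` C) \<partial>?T)"
    by (rule PP.emeasure_pair_measure_alt[OF C'])
  also have "\<dots> = (\<integral>\<^sup>+ \<omega>. emeasure path_prob (Pair (sample_path T \<omega>) -` C) \<partial>N)"
    using PP.measurable_emeasure_Pair[OF C'] by (subst nn_integral_distr) auto
  also have "\<dots> = (\<integral>\<^sup>+ \<omega>. (\<Prod>i<n. incr_prob (A i) (T (\<tau> (Suc i)) \<omega> - T (\<tau> i) \<omega>)) \<partial>N)"
  proof (rule nn_integral_cong_AE)
    have "AE \<omega> in N. \<forall>i j. i \<le> j \<longrightarrow> j \<le> n \<longrightarrow> T (\<tau> i) \<omega> \<le> T (\<tau> j) \<omega>"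
      unfolding AE_all_countable by (auto intro!: T_mono_AE pos le)
    then show "AE \<omega> in N. emeasure path_prob (Pair (sample_path T \<omega>) -` C)
        = (\<Prod>i<n. incr_prob (A i) (T (\<tau> (Suc i)) \<omega> - T (\<tau> i) \<omega>))"
      using AE_space
    proof eventually_elim
      case (elim \<omega>)
      \<comment> \<open>From here \<open>\<omega>\<close> only fixes the times, while the
        probability is taken over a separate point \<open>\<omega>'\<close>.\<close>
      have "emeasure path_prob (Pair (sample_path T \<omega>) -` C)
          = emeasure N (Pair (sample_path T \<omega>) -` C \<inter> space N)"
        by (simp add: path_prob_def emeasure_distr sets_Pair1[OF C])
      also have "Pair (sample_path T \<omega>) -` C \<inter> space N
          = {\<omega>' \<in> space N. \<forall>i<n. Y_max (T (\<tau> (Suc i)) \<omega>) \<omega>' - Y_max (T (\<tau> i) \<omega>) \<omega>' \<in> A i}"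
        using T_space[OF elim(2)] by (auto simp: C_def space_pair_measure pos)
      also have "emeasure N \<dots> = (\<Prod>i<n. incr_prob (A i) (T (\<tau> (Suc i)) \<omega> - T (\<tau> i) \<omega>))"
        using elim \<tau> by (intro Y'_increments A) (auto intro!: T_nonneg mono_onI)
      finally show ?case .
    qed
  qed
  finally show ?thesis .
qed

lemma subord_increment_cond:
  assumes "0 \<le> s" "s \<le> t" "A \<in> sets borel"
  shows "emeasure N {\<omega> \<in> space N. subord t \<omega> - subord s \<omega> \<in> A} = (\<integral>\<^sup>+ \<omega>. incr_prob A (T t \<omega> - T s \<omega>) \<partial>N)"
  using subord_increments_cond[of "\<lambda>i. if i = 0 then s else t" 1 "\<lambda>_. A"] assms
  by (auto simp: mono_on_def)

text \<open>By conditioning, the probability depends on \<open>T\<close> only through the law of a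
  single increment.\<close>

lemma subord_increment_stationary:
  assumes "0 \<le> s" "0 \<le> h" and A [measurable]: "A \<in> sets borel"
  shows "prob {\<omega> \<in> space N. subord (s + h) \<omega> - subord s \<omega> \<in> A} = prob {\<omega> \<in> space N. subord h \<omega> - subord 0 \<omega> \<in> A}"
proof -
  note [simp] = assms(1,2)
  have stat: "distr N borel (\<lambda>\<omega>. T (s + h) \<omega> - T s \<omega>) = distr N borel (\<lambda>\<omega>. T h \<omega> - T 0 \<omega>)"
    using levy_T by (auto simp: positive_levy_process_def levy_process_def stationary_increments_def)
  have "emeasure N {\<omega> \<in> space N. subord (s + h) \<omega> - subord s \<omega> \<in> A}
      = (\<integral>\<^sup>+ x. incr_prob A x \<partial>distr N borel (\<lambda>\<omega>. T (s + h) \<omega> - T s \<omega>))"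
    by (subst nn_integral_distr) (auto simp: subord_increment_cond)
  also have "\<dots> = emeasure N {\<omega> \<in> space N. subord h \<omega> - subord 0 \<omega> \<in> A}"
    unfolding stat by (subst nn_integral_distr) (auto simp: subord_increment_cond)
  finally show ?thesis by (simp add: emeasure_eq_measure)
qed

lemma subord_independent_increments: "independent_increments N subord"
  unfolding independent_increments_iff[OF subord_real]
proof safe
  fix n :: nat and \<tau> :: "nat \<Rightarrow> real" and A :: "nat \<Rightarrow> real set"
  assume \<tau>: "0 \<le> \<tau> 0" "mono_on {..n} \<tau>" and "\<forall>i. A i \<in> sets borel"
  then have A [measurable]: "\<And>i. A i \<in> sets borel" by auto
  have le: "\<tau> i \<le> \<tau> j" if "i \<le> j" "j \<le> n" for i j
    using \<tau> that by (auto elim!: mono_onD)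
  then have pos: "0 \<le> \<tau> i" if "i \<le> n" for i
    using \<tau>(1) that order_trans by blast
  have "indep_vars (\<lambda>_. borel) (\<lambda>i \<omega>. T (\<tau> (Suc i)) \<omega> - T (\<tau> i) \<omega>) {..<n}"
    using levy_T \<tau> unfolding positive_levy_process_def levy_process_def independent_increments_def by blast
  then have "indep_vars (\<lambda>_. borel) (\<lambda>i \<omega>. incr_prob (A i) (T (\<tau> (Suc i)) \<omega> - T (\<tau> i) \<omega>)) {..<n}"
    by (rule indep_vars_compose2) measurable
  then have "emeasure N {\<omega> \<in> space N. \<forall>i<n. subord (\<tau> (Suc i)) \<omega> - subord (\<tau> i) \<omega> \<in> A i}
      = (\<Prod>i<n. \<integral>\<^sup>+ \<omega>. incr_prob (A i) (T (\<tau> (Suc i)) \<omega> - T (\<tau> i) \<omega>) \<partial>N)"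
    by (simp add: subord_increments_cond[OF \<tau> A] indep_vars_nn_integral)
  also have "\<dots> = (\<Prod>i<n. emeasure N {\<omega> \<in> space N. subord (\<tau> (Suc i)) \<omega> - subord (\<tau> i) \<omega> \<in> A i})"
    by (intro prod.cong refl subord_increment_cond[symmetric] A pos le) auto
  finally show "prob {\<omega> \<in> space N. \<forall>i<n. subord (\<tau> (Suc i)) \<omega> - subord (\<tau> i) \<omega> \<in> A i}
      = (\<Prod>i<n. prob {\<omega> \<in> space N. subord (\<tau> (Suc i)) \<omega> - subord (\<tau> i) \<omega> \<in> A i})"
    by (simp add: emeasure_eq_measure prod_ennreal prod_nonneg)
qed

text \<open>Stationarity reduces the claim to time 0. There either \<open>T\<close> has moved
  little, and then so has \<open>Y'\<close> with high probability, or \<open>T\<close> has moved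
  far, which is itself improbable.\<close>

lemma subord_stochastically_continuous: "stochastically_continuous N subord"
  unfolding stochastically_continuous_def
proof (intro allI impI tendstoI)
  fix t \<epsilon> e :: real assume t: "0 \<le> t" and eps: "0 < \<epsilon>" and e: "0 < e"
  define A where "A = {x::real. \<bar>x\<bar> > \<epsilon>}"
  have A [measurable]: "A \<in> sets borel" unfolding A_def by measurable
  have "stochastically_continuous N Y'" using levy_Y' by (simp add: levy_process_def)
  then have "((\<lambda>s. prob {\<omega> \<in> space N. \<bar>Y' s \<omega> - Y' 0 \<omega>\<bar> > \<epsilon>}) \<longlongrightarrow> 0) (at 0 within {0..})"
    using eps by (auto simp: stochastically_continuous_def)
  then have "\<forall>\<^sub>F s in at 0 within {0..}. prob {\<omega> \<in> space N. \<bar>Y' s \<omega> - Y' 0 \<omega>\<bar> > \<epsilon>} < e / 2"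
    by (rule order_tendstoD) (use e in simp)
  then obtain d where d: "0 < d" "\<And>s. 0 < s \<Longrightarrow> s < d \<Longrightarrow> prob {\<omega> \<in> space N. \<bar>Y' s \<omega> - Y' 0 \<omega>\<bar> > \<epsilon>} < e / 2"
    by (auto simp: eventually_at dist_real_def)
  \<comment> \<open>The choice of \<open>d\<close> says nothing about time 0, where the increment
    vanishes. Halving \<open>d\<close> turns its strict range into a closed one, complementary to
    the event in \<open>?p\<close>.\<close>
  have small: "incr_prob A r \<le> ennreal (e / 2)" if "0 \<le> r" "r \<le> d / 2" for r
  proof (cases "r = 0")
    case True
    then show ?thesis using eps by (simp add: incr_prob_def A_def)
  next
    case False
    then have "prob {\<omega> \<in> space N. \<bar>Y' r \<omega> - Y' 0 \<omega>\<bar> > \<epsilon>} < e / 2"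
      using that d(1) by (intro d(2)) auto
    then show ?thesis using that
      by (auto simp: incr_prob_def A_def Y_max_def emeasure_eq_measure intro!: ennreal_leI)
  qed
  have le1: "incr_prob A r \<le> 1" for r
    by (simp add: incr_prob_def emeasure_eq_measure)
  let ?p = "\<lambda>h. prob {\<omega> \<in> space N. \<bar>T h \<omega> - T 0 \<omega>\<bar> > d / 2}"
  have bound: "prob {\<omega> \<in> space N. subord h \<omega> - subord 0 \<omega> \<in> A} \<le> e / 2 + ?p h" if h: "0 \<le> h" for h
  proof -
    let ?S = "{\<omega> \<in> space N. \<bar>T h \<omega> - T 0 \<omega>\<bar> > d / 2}"
    note [simp] = h
    have [measurable]: "?S \<in> sets N" by measurable
    have "emeasure N {\<omega> \<in> space N. subord h \<omega> - subord 0 \<omega> \<in> A} = (\<integral>\<^sup>+ \<omega>. incr_prob A (T h \<omega> - T 0 \<omega>) \<partial>N)"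
      by (intro subord_increment_cond) (auto simp: A)
    also have "\<dots> \<le> (\<integral>\<^sup>+ \<omega>. ennreal (e / 2) + indicator ?S \<omega> \<partial>N)"
    proof (rule nn_integral_mono_AE)
      show "AE \<omega> in N. incr_prob A (T h \<omega> - T 0 \<omega>) \<le> ennreal (e / 2) + indicator ?S \<omega>"
        using T_mono_AE[OF order_refl h] AE_space
      proof eventually_elim
        case (elim \<omega>)
        show ?case
        proof (cases "\<omega> \<in> ?S")
          case True
          then show ?thesis using le1[of "T h \<omega> - T 0 \<omega>"] by (simp add: add_increasing)
        next
          case False
          then show ?thesis using elim small[of "T h \<omega> - T 0 \<omega>"] by simp
        qed
      qed
    qed
    also have "\<dots> = ennreal (e / 2) + emeasure N ?S"
      by (subst nn_integral_add) (auto simp: emeasure_space_1)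
    also have "\<dots> = ennreal (e / 2 + ?p h)"
      using e by (simp add: emeasure_eq_measure ennreal_plus)
    finally have "ennreal (prob {\<omega> \<in> space N. subord h \<omega> - subord 0 \<omega> \<in> A}) \<le> ennreal (e / 2 + ?p h)"
      by (simp only: emeasure_eq_measure)
    then show ?thesis using e by (subst (asm) ennreal_le_iff) auto
  qed
  have "stochastically_continuous N T"
    using levy_T by (simp add: positive_levy_process_def levy_process_def)
  then have "(?p \<longlongrightarrow> 0) (at 0 within {0..})"
    unfolding stochastically_continuous_def using half_gt_zero[OF d(1)] by blast
  then have "\<forall>\<^sub>F h in at 0 within {0..}. ?p h < e / 2"
    by (rule order_tendstoD) (use e in simp)
  then obtain d' where d': "0 < d'" "\<And>h. 0 < h \<Longrightarrow> h < d' \<Longrightarrow> ?p h < e / 2"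
    by (auto simp: eventually_at dist_real_def)
  show "\<forall>\<^sub>F s in at t within {0..}. dist (prob {\<omega> \<in> space N. \<bar>subord s \<omega> - subord t \<omega>\<bar> > \<epsilon>}) 0 < e"
    unfolding eventually_at
  proof (intro exI[of _ d'] conjI ballI impI d')
    fix s assume s: "s \<in> {0..}" "s \<noteq> t \<and> dist s t < d'"
    \<comment> \<open>\<open>A\<close> is symmetric, so the orders s \<le> t and t \<le> s become
      the same forward increment.\<close>
    have "prob {\<omega> \<in> space N. \<bar>subord s \<omega> - subord t \<omega>\<bar> > \<epsilon>}
        = prob {\<omega> \<in> space N. subord (min s t + \<bar>s - t\<bar>) \<omega> - subord (min s t) \<omega> \<in> A}"
      by (auto simp: A_def min_def abs_minus_commute intro!: arg_cong[where f=prob])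
    also have "\<dots> = prob {\<omega> \<in> space N. subord \<bar>s - t\<bar> \<omega> - subord 0 \<omega> \<in> A}"
      using s t by (intro subord_increment_stationary A) auto
    also have "\<dots> < e"
      using bound[of "\<bar>s - t\<bar>"] d'(2)[of "\<bar>s - t\<bar>"] s by (auto simp: dist_real_def)
    finally show "dist (prob {\<omega> \<in> space N. \<bar>subord s \<omega> - subord t \<omega>\<bar> > \<epsilon>}) 0 < e" by simp
  qed
qed

lemma levy_subord: "levy_process N subord"
proof -
  have "AE \<omega> in N. Y' 0 \<omega> = 0" using levy_Y' by (simp add: levy_process_def)
  with T_zero have "AE \<omega> in N. subord 0 \<omega> = 0" by eventually_elim (simp add: subord_def)
  moreover have "stationary_increments N subord"
    unfolding stationary_increments_iff[OF subord_real] using subord_increment_stationary by auto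
  ultimately show ?thesis
    using subord_real subord_independent_increments subord_stochastically_continuous by (simp add: levy_process_def)
qed

section \<open>Characteristic functions at an independent random time\<close>

text \<open>The law of \<open>Y' V\<close> for \<open>V\<close> distributed as \<open>\<nu>\<close> and independent of \<open>Y'\<close>.\<close>

definition mixture :: "real measure \<Rightarrow> real measure" where
  "mixture \<nu> = distr (\<nu> \<Otimes>\<^sub>M path_prob) borel (\<lambda>(s, \<omega>). Y_max s \<omega>)"

lemma measurable_Y_max_pair:
  assumes "real_distribution \<nu>"
  shows "(\<lambda>(s, \<omega>). Y_max s \<omega>) \<in> borel_measurable (\<nu> \<Otimes>\<^sub>M path_prob)"
proof -
  have "sets (\<nu> \<Otimes>\<^sub>M path_prob) = sets (borel \<Otimes>\<^sub>M path_algebra)"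
    using real_distribution.events_eq_borel[OF assms]
    by (intro sets_pair_measure_cong sets_path_prob) simp
  then show ?thesis using measurable_Y_max measurable_cong_sets by blast
qed

lemma real_distribution_mixture:
  assumes "real_distribution \<nu>"
  shows "real_distribution (mixture \<nu>)"
proof -
  interpret \<nu>: real_distribution \<nu> by fact
  interpret PP: prob_space path_prob by (rule prob_space_path_prob)
  interpret pair_prob_space \<nu> path_prob ..
  show ?thesis unfolding mixture_def
    by (intro real_distribution_distr measurable_Y_max_pair assms)
qed

text \<open>By Fubini the inner integral is the characteristic function of \<open>Y\<close> at a
  fixed time, and integrating exp (- s z) over the time gives the Laplace transform of
  \<open>\<nu>\<close> at the complex point \<open>z\<close>.\<close>

lemma char_mixture:
  assumes \<nu>: "nonneg_distribution \<nu>"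
    and exponent: "\<And>s. 0 \<le> s \<Longrightarrow> char (distr N borel (Y s)) u = exp (- (of_real s * z))"
  shows "char (mixture \<nu>) u = (CLINT s|\<nu>. exp (- (z * of_real s)))"
proof -
  have rd: "real_distribution \<nu>" and ae: "AE s in \<nu>. 0 \<le> s"
    using \<nu> by (auto simp: nonneg_distribution_def)
  interpret \<nu>: real_distribution \<nu> by fact
  interpret PP: prob_space path_prob by (rule prob_space_path_prob)
  interpret PR: pair_prob_space \<nu> path_prob ..
  note [measurable] = measurable_Y_max_pair[OF rd]
  have "char (mixture \<nu>) u = (CLINT x|(\<nu> \<Otimes>\<^sub>M path_prob). iexp (u * (case x of (s, \<omega>) \<Rightarrow> Y_max s \<omega>)))"
    by (simp add: char_def mixture_def integral_distr)
  also have "\<dots> = (CLINT s|\<nu>. (CLINT \<omega>|path_prob. iexp (u * Y_max s \<omega>)))"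
    by (subst PR.integral_fst'[symmetric]) (auto intro!: PR.integrable_iexp)
  also have "\<dots> = (CLINT s|\<nu>. exp (- (z * of_real s)))"
  proof (rule integral_cong_AE)
    show "AE s in \<nu>. (CLINT \<omega>|path_prob. iexp (u * Y_max s \<omega>)) = exp (- (z * of_real s))"
      using ae
    proof eventually_elim
      case (elim s)
      have "(CLINT \<omega>|path_prob. iexp (u * Y_max s \<omega>)) = (CLINT \<omega>|N. iexp (u * Y_max s \<omega>))"
        unfolding path_prob_def by (rule integral_distr) measurable
      also have "\<dots> = (CLINT \<omega>|N. iexp (u * Y s \<omega>))"
      proof (rule integral_cong_AE)
        have "AE \<omega> in N. Y' s \<omega> = Y s \<omega>" using mod elim by (auto simp: modification_def)
        then show "AE \<omega> in N. iexp (u * Y_max s \<omega>) = iexp (u * Y s \<omega>)"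
          by eventually_elim (use elim in \<open>simp add: Y_max_def\<close>)
      qed (use elim in measurable)
      also have "\<dots> = char (distr N borel (Y s)) u"
        using elim by (simp add: char_def integral_distr)
      finally show ?case using exponent[OF elim] by (simp add: mult.commute)
    qed
    show "(\<lambda>s. CLINT \<omega>|path_prob. iexp (u * Y_max s \<omega>)) \<in> borel_measurable \<nu>"
      by (rule PP.borel_measurable_lebesgue_integral) simp
  qed simp
  finally show ?thesis .
qed

text \<open>The image of the product law of \<open>T t\<close> and the sample point under evaluation
  of \<open>Y_max\<close>; through this, the one-dimensional laws of \<open>subord\<close> come
  within reach of \<open>char_mixture\<close>.\<close>

lemma distr_subord_eq_mixture:
  assumes "0 \<le> t"
  shows "distr N borel (subord t) = mixture (distr N borel (T t))"
proof -
  have "(\<lambda>x. x t) \<in> borel_measurable path_space"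
    using assms by (intro measurable_component_singleton) auto
  from distr_T_path_pair[OF this] assms
  have "mixture (distr N borel (T t)) = distr (distr N (borel \<Otimes>\<^sub>M path_algebra) (\<lambda>\<omega>. (T t \<omega>, \<omega>))) borel (\<lambda>(s, \<omega>). Y_max s \<omega>)"
    by (simp add: mixture_def)
  also have "\<dots> = distr N borel (\<lambda>\<omega>. Y_max (T t \<omega>) \<omega>)"
    using assms measurable_Y_max by (subst distr_distr) (auto simp: comp_def)
  also have "\<dots> = distr N borel (subord t)"
    using assms by (intro distr_cong) (auto simp: subord_eq)
  finally show ?thesis ..
qed

end


section \<open>Semi-selfdecomposability\<close>

lemma of_real_laplace_transform:
  "complex_of_real (laplace_transform \<mu> s) = (CLINT x|\<mu>. exp (- (of_real s * of_real x)))"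
  unfolding laplace_transform_def by (simp flip: integral_complex_of_real exp_of_real)

text \<open>\<open>\<rho>\<close> is the law of c S + V with S and V independent, distributed as
  \<open>\<mu>\<close> and \<open>\<nu>\<close>, so its transform factorizes.\<close>

lemma nonneg_distribution_scaled_sum:
  fixes c :: real
  assumes \<mu>: "nonneg_distribution \<mu>" and \<nu>: "nonneg_distribution \<nu>" and c: "0 \<le> c"
  defines "\<rho> \<equiv> distr (\<mu> \<Otimes>\<^sub>M \<nu>) borel (\<lambda>(x, v). c * x + v)"
  shows "nonneg_distribution \<rho>"
    and "0 \<le> Re z \<Longrightarrow> (CLINT x|\<rho>. exp (- (z * of_real x)))
           = (CLINT x|\<mu>. exp (- (of_real c * z * of_real x))) * (CLINT x|\<nu>. exp (- (z * of_real x)))"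
proof -
  interpret \<mu>: real_distribution \<mu> using \<mu> by (simp add: nonneg_distribution_def)
  interpret \<nu>: real_distribution \<nu> using \<nu> by (simp add: nonneg_distribution_def)
  interpret PR: pair_prob_space \<mu> \<nu> ..
  have ae: "AE x in \<mu>. 0 \<le> x" "AE x in \<nu>. 0 \<le> x"
    using \<mu> \<nu> by (auto simp: nonneg_distribution_def)
  have [measurable]: "(\<lambda>(x, v). c * x + v) \<in> borel_measurable (\<mu> \<Otimes>\<^sub>M \<nu>)"
    by measurable
  have "AE x in \<mu> \<Otimes>\<^sub>M \<nu>. 0 \<le> (case x of (x, v) \<Rightarrow> c * x + v)"
  proof (rule PR.AE_pair_measure)
    show "AE x in \<mu>. AE v in \<nu>. 0 \<le> (case (x, v) of (x, v) \<Rightarrow> c * x + v)"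
      using ae(1)
    proof eventually_elim
      case (elim x)
      show ?case using ae(2) by eventually_elim (use elim c in simp)
    qed
  qed measurable
  then show nonneg: "nonneg_distribution \<rho>"
    unfolding nonneg_distribution_def \<rho>_def
    by (auto intro!: PR.real_distribution_distr simp: AE_distr_iff)
  assume z: "0 \<le> Re z"
  have "integrable \<rho> (\<lambda>x. exp (- (z * of_real x)))"
    by (rule nonneg_integrable_exp[OF nonneg z])
  then have int: "integrable (\<mu> \<Otimes>\<^sub>M \<nu>) (\<lambda>x. exp (- (z * of_real (case x of (x, v) \<Rightarrow> c * x + v))))"
    unfolding \<rho>_def by (subst (asm) integrable_distr_eq) auto
  have "(CLINT x|\<rho>. exp (- (z * of_real x))) = (CLINT x|(\<mu> \<Otimes>\<^sub>M \<nu>). exp (- (z * of_real (case x of (x, v) \<Rightarrow> c * x + v))))"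
    unfolding \<rho>_def by (subst integral_distr) auto
  also have "\<dots> = (CLINT x|\<mu>. (CLINT v|\<nu>. exp (- (of_real c * z * of_real x)) * exp (- (z * of_real v))))"
    by (subst PR.integral_fst'[OF int, symmetric]) (simp add: algebra_simps flip: exp_add)
  finally show "(CLINT x|\<rho>. exp (- (z * of_real x)))
     = (CLINT x|\<mu>. exp (- (of_real c * z * of_real x))) * (CLINT x|\<nu>. exp (- (z * of_real x)))"
    by simp
qed

text \<open>Uniqueness compares two distributions, whereas the right side of \<open>L\<close> is a
  product. That product is the Laplace transform of the scaled sum, and this law factorizes at
  complex arguments as well.\<close>

lemma semi_selfdecomposable_complex_laplace:
  assumes \<mu>: "nonneg_distribution \<mu>" and \<nu>: "nonneg_distribution \<nu>" and c: "0 \<le> c" and z: "0 \<le> Re z"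
    and L: "\<And>s. 0 < s \<Longrightarrow> laplace_transform \<mu> s = laplace_transform \<mu> (c * s) * laplace_transform \<nu> s"
  shows "(CLINT x|\<mu>. exp (- (z * of_real x)))
     = (CLINT x|\<mu>. exp (- (of_real c * z * of_real x))) * (CLINT x|\<nu>. exp (- (z * of_real x)))"
proof -
  let ?\<rho> = "distr (\<mu> \<Otimes>\<^sub>M \<nu>) borel (\<lambda>(x, v). c * x + v)"
  note sum = nonneg_distribution_scaled_sum[OF \<mu> \<nu> c]
  have "laplace_transform \<mu> s = laplace_transform ?\<rho> s" if "0 < s" for s
  proof -
    have "complex_of_real (laplace_transform ?\<rho> s)
        = complex_of_real (laplace_transform \<mu> (c * s) * laplace_transform \<nu> s)"
      using sum(2)[of "of_real s"] that by (simp add: of_real_laplace_transform)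
    then show ?thesis using L[OF that] by (simp only: of_real_eq_iff)
  qed
  from complex_laplace_unique[OF \<mu> sum(1) this z] sum(2)[OF z] show ?thesis by simp
qed

theorem mainTheorem5:
  fixes a b \<alpha> :: real
    and N :: "'a measure" and Y T :: "real \<Rightarrow> 'a \<Rightarrow> real"
    and M :: "'b measure" and X :: "real \<Rightarrow> 'b \<Rightarrow> real"
  assumes "0 < b" and "b < 1" and "1 < a"
    and "0 < \<alpha>" and "\<alpha> \<le> 2" and "a * b powr \<alpha> = 1"
    and "semi_stable_process a b N Y"
    and "positive_semi_selfdecomposable_process (b powr \<alpha>) N T"
    and "indep_processes N Y T"
    and "subordinated_by M X N Y T"
  shows "semi_selfdecomposable_process b M X"
proof -
  obtain Y' where sub: "levy_process N Y" "positive_levy_process N T" "measurable_process N Y'" "modification N Y' Y"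
      and X: "real_process M X" and law: "process_law M X = process_law N (\<lambda>t \<omega>. Y' (T t \<omega>) \<omega>)"
    using assms(10) by (auto simp: subordinated_by_def)
  interpret subordination N Y Y' T
    using sub assms(9) by unfold_locales
  have law_subord: "process_law M X = process_law N subord"
    unfolding law by (rule arg_cong[where f="process_law N"]) (simp add: fun_eq_iff subord_def)
  have levy_X: "levy_process M X"
    by (rule levy_process_law_cong[OF law_subord X levy_subord])
  define \<mu> where "\<mu> = distr N borel (T 1)"
  have "distr M borel (X 1) = distr N borel (subord 1)"
  proof -
    have "distr (process_law K V) borel (\<lambda>x. x 1) = distr K borel (V 1)"
      if "real_process K V" for K :: "'c measure" and V
      unfolding process_law_def
      by (subst distr_distr) (auto simp: comp_def measurable_sample_path that intro!: measurable_component_singleton)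
    from this[OF X] this[OF subord_real] law_subord show ?thesis by simp
  qed
  then have X1: "distr M borel (X 1) = mixture \<mu>"
    by (simp add: distr_subord_eq_mixture \<mu>_def)
  obtain \<psi> where \<psi>: "continuous_on UNIV \<psi>" "\<And>u. char (distr N borel (Y 1)) u = exp (- \<psi> u)"
      and scale: "\<And>u. \<psi> u = complex_of_real a * \<psi> (b * u)"
    using assms(7) unfolding semi_stable_process_def semi_stable_def by blast
  have \<psi>_0: "\<psi> 0 = 0"
    using scale[of 0] \<open>1 < a\<close> by simp
  note exponent = levy_char_exponent[OF levy_Y _ \<psi>(1) \<psi>_0 \<psi>(2)]
  have Re: "0 \<le> Re (\<psi> u)" for u
    by (rule levy_exponent_Re_nonneg[OF real_distribution_distr \<psi>(2)]) simp
  obtain \<nu> where \<mu>: "nonneg_distribution \<mu>" and \<nu>: "nonneg_distribution \<nu>"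
      and L: "\<And>s. 0 < s \<Longrightarrow> laplace_transform \<mu> s = laplace_transform \<mu> (b powr \<alpha> * s) * laplace_transform \<nu> s"
    using assms(8)
    by (auto simp: positive_semi_selfdecomposable_process_def semi_selfdecomposable_nonneg_def \<mu>_def)
  have "char (mixture \<mu>) u = char (mixture \<mu>) (b * u) * char (mixture \<nu>) u" for u
  proof -
    \<comment> \<open>Since b powr \<alpha> = 1 / a, multiplying by it solves the functional
      equation for \<psi> (b u). Scaling \<open>u\<close> by b thus scales the Laplace variable by b
      powr \<alpha>, the constant for which \<open>T\<close> is semi-selfdecomposable.\<close>
    have "complex_of_real (b powr \<alpha>) * \<psi> u = complex_of_real (a * b powr \<alpha>) * \<psi> (b * u)"
      by (subst scale) simp
    then have "\<psi> (b * u) = of_real (b powr \<alpha>) * \<psi> u"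
      using assms(6) by simp
    then show ?thesis
      using semi_selfdecomposable_complex_laplace[OF \<mu> \<nu> _ Re L, of u]
      by (simp add: char_mixture[OF \<mu> exponent] char_mixture[OF \<nu> exponent])
  qed
  moreover have "real_distribution (mixture \<mu>)" "real_distribution (mixture \<nu>)"
    using \<mu> \<nu> by (auto intro!: real_distribution_mixture simp: nonneg_distribution_def)
  ultimately show ?thesis
    using levy_X unfolding semi_selfdecomposable_process_def semi_selfdecomposable_def X1 by blast
qed


end
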